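(* Let $T>0$, $c>0$, let $h:\mathbb{R}\to\mathbb{R}$ be continuous and $T$-periodic, and let $g=g(t,x)\in C^1(\mathbb{R}\times\mathbb{R})$ be $T$-periodic in $t$. Write $g'(t,x)=\partial g/\partial x(t,x)$. Assume that (1) the function $\alpha(t):=\sup_{x\in\mathbb{R}} g'(t,x)$ satisfies $\alpha(t)\ll \frac{\pi^2}{T^2}+\frac{c^2}{4}$; (2) there is a continuous $T$-periodic function $\beta$ with $\int_0^T\beta(t)\,dt>0$ such that $g'(t,x)\gg\beta(t)$ for all $x\in\mathbb{R}$. Then the differential equation $$x''+cx'+g(t,x)=h(t)$$ has a unique $T$-periodic solution, and this solution is asymptotically stable.
   Context: Notation: for $T$-periodic functions $a,b$ of $t$, $a(t)\gg b(t)$ (equivalently $b(t)\ll a(t)$) means $a(t)\ge b(t)$ on $[0,T]$ and $a(t)>b(t)$ on some subset of $[0,T]$ of positive measure. In (2), the relation $g'(t,x)\gg\beta(t)$ is between functions of $t$, for each fixed $x$. Stability: a $T$-periodic solution $x_0$ of the equation is (locally) asymptotically stable if there exist constants $C>0$ and $\gamma>0$ such that, whenever $x$ is another solution with $d=|x(0)-x_0(0)|+|x'(0)-x_0'(0)|$ sufficiently small, one has $|x(t)-x_0(t)|+|x'(t)-x_0'(t)|<C\,d\,e^{-\gamma t}$ for $t\ge 0$. *)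

theory Defs
  imports "HOL-Analysis.Analysis"
begin

definition continuously_differentiable ::
    "('a::real_normed_vector \<Rightarrow> 'b::real_normed_vector) \<Rightarrow> bool" where
  "continuously_differentiable f \<longleftrightarrow>
     (\<exists>f'. (\<forall>z. (f has_derivative blinfun_apply (f' z)) (at z)) \<and> continuous_on UNIV f')"

(* The relation b << a between T-periodic functions. It is polymorphic in the
   codomain so that it also applies to extended-real-valued suprema. *)
definition much_less :: "real \<Rightarrow> (real \<Rightarrow> 'a::linorder) \<Rightarrow> (real \<Rightarrow> 'a) \<Rightarrow> bool" where
  "much_less T b a \<longleftrightarrow>
     (\<forall>t\<in>{0..T}. b t \<le> a t) \<and>
     (\<exists>S\<in>sets lebesgue. S \<subseteq> {0..T} \<and> emeasure lebesgue S > 0 \<and> (\<forall>t\<in>S. b t < a t))"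

definition dx :: "(real \<Rightarrow> real \<Rightarrow> real) \<Rightarrow> real \<Rightarrow> real \<Rightarrow> real" where
  "dx g t x = deriv (\<lambda>y. g t y) x"

(* x solves x'' + c x' + g(t,x) = h(t) on I, the second function being its
   derivative there (one-sided at end points of I). *)
definition duffing_solution_on ::
    "real set \<Rightarrow> real \<Rightarrow> (real \<Rightarrow> real \<Rightarrow> real) \<Rightarrow> (real \<Rightarrow> real) \<Rightarrow>
     (real \<Rightarrow> real) \<Rightarrow> (real \<Rightarrow> real) \<Rightarrow> bool" where
  "duffing_solution_on I c g h x x' \<longleftrightarrow>
     (\<exists>x''. \<forall>t\<in>I. (x has_real_derivative x' t) (at t within I) \<and>
                  (x' has_real_derivative x'' t) (at t within I) \<and>
                  x'' t + c * x' t + g t (x t) = h t)"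

definition periodic_solution ::
    "real \<Rightarrow> real \<Rightarrow> (real \<Rightarrow> real \<Rightarrow> real) \<Rightarrow> (real \<Rightarrow> real) \<Rightarrow> (real \<Rightarrow> real) \<Rightarrow> bool" where
  "periodic_solution T c g h x \<longleftrightarrow>
     periodic_fun_simple x T \<and> duffing_solution_on UNIV c g h x (deriv x)"

(* The competing solutions x are only required to solve the equation for
   t >= 0; "another" solution means one that differs from x0 there. *)
definition asymptotically_stable ::
    "real \<Rightarrow> (real \<Rightarrow> real \<Rightarrow> real) \<Rightarrow> (real \<Rightarrow> real) \<Rightarrow> (real \<Rightarrow> real) \<Rightarrow> bool" where
  "asymptotically_stable c g h x0 \<longleftrightarrow>
     (\<exists>C>0. \<exists>\<gamma>>0. \<exists>\<delta>>0. \<forall>x x'.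
        duffing_solution_on {0..} c g h x x' \<longrightarrow> (\<exists>t\<ge>0. x t \<noteq> x0 t) \<longrightarrow>
        (let d = \<bar>x 0 - x0 0\<bar> + \<bar>x' 0 - deriv x0 0\<bar>
         in d < \<delta> \<longrightarrow>
            (\<forall>t\<ge>0. \<bar>x t - x0 t\<bar> + \<bar>x' t - deriv x0 t\<bar> < C * d * exp (- \<gamma> * t))))"

end

theory Submission
  imports Defs
begin

text \<open>The difference \<open>u\<close> of two solutions satisfies \<open>u'' + c u' + a(t) u = 0\<close> with
  \<open>\<beta> \<le> a \<le> \<alpha>\<close>. The whole proof rests on the real eigenvalues \<open>r\<close> of the monodromy matrix \<open>M\<close>
  of such an equation over \<open>[0, T]\<close>, whose determinant is \<open>exp (- c T)\<close>.

  If \<open>r > 0\<close>, a zero of the corresponding solution would force a second one at distance less than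
  \<open>T\<close>, which Sturm comparison with \<open>\<pi>\<^sup>2 / T\<^sup>2 + c\<^sup>2 / 4\<close> forbids; integrating the Riccati equation of
  \<open>u' / u\<close> then gives \<open>r \<le> exp (- \<integral>\<beta> / c) < 1\<close>. Hence \<open>det (I - M)\<close> is bounded below by a
  positive constant which does not depend on \<open>a\<close>, so that \<open>I - P\<close>, with \<open>P\<close> the Poincare map, is
  expansive: it is injective, its range is closed, and also open by invariance of domain. Thus \<open>P\<close>
  has exactly one fixed point.

  If \<open>r < 0\<close>, Sturm comparison gives \<open>r > - 1\<close>. So for \<open>a(t) = g'(t, x\<^sub>0(t))\<close> both multipliers lie in
  the open unit disc, \<open>M\<close> is a contraction in an adapted norm, and so is \<open>P\<close> near the fixed point.\<close>

section \<open>Global solutions and growth bounds\<close>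

text \<open>The constant of the upper bound comes from \<open>u = exp (- c t / 2) v\<close>, which
  turns the equation into \<open>v'' + (a - c^2 / 4) v = 0\<close>; the comparison equation with
  coefficient \<open>(pi / T)^2\<close> has half-period exactly \<open>T\<close>. The lower function
  \<beta> may be negative on part of the period, so only its mean can help, and the mean enters
  through the Riccati equation, which makes sense only along a solution without zeros. Hence zeros
  are excluded before the multiplier is estimated. For existence and uniqueness, \<open>a\<close> is
  an averaged derivative of \<open>g\<close> along a pair of solutions and varies with the pair; the
  estimates of positive multipliers and of the determinant see only \<open>c\<close>,
  \<open>T\<close> and the integral of \<beta>, which makes them uniform. For stability,
  \<open>a\<close> is fixed and the Poincare map is compared with the monodromy matrix directly over
  one period, so its differentiability is never discussed. The bounds on the derivative of
  \<open>g\<close> make it Lipschitz in \<open>x\<close> uniformly in \<open>t\<close>: solutions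
  exist for all \<open>t \<ge> 0\<close>, and the Poincare map is defined on the whole
  plane.\<close>

lemma nondecreasing_within:
  fixes f :: "real \<Rightarrow> real"
  assumes "a \<le> b"
    and der: "\<And>t. t \<in> {a..b} \<Longrightarrow> (f has_real_derivative f' t) (at t within {a..b})"
    and nonneg: "\<And>t. t \<in> {a<..<b} \<Longrightarrow> 0 \<le> f' t"
  shows "f a \<le> f b"
proof (rule DERIV_nonneg_imp_increasing_open[OF \<open>a \<le> b\<close>])
  show "continuous_on {a..b} f"
    using der by (meson DERIV_continuous continuous_on_eq_continuous_within)
next
  fix t assume t: "a < t" "t < b"
  then have "(f has_real_derivative f' t) (at t)"
    using der[of t] by (simp add: at_within_Icc_at)
  then show "\<exists>y. DERIV f t :> y \<and> 0 \<le> y"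
    using nonneg[of t] t by auto
qed

text \<open>Gronwall's inequality for the squared norm, which is differentiable even where
  \<open>z\<close> vanishes. The exponent collects \<open>2 L\<close> from the linear term and 1
  from \<open>2 e |z| \<le> |z|^2 + e^2\<close>.\<close>

lemma norm_growth_bound:
  fixes z :: "real \<Rightarrow> 'a::real_inner"
  assumes der: "\<And>t. t \<in> {0..b} \<Longrightarrow> (z has_vector_derivative z' t) (at t within {0..b})"
    and bound: "\<And>t. t \<in> {0..b} \<Longrightarrow> norm (z' t) \<le> L * norm (z t) + e"
    and "0 \<le> e" "0 \<le> L" "t \<in> {0..b}"
  shows "(norm (z t))\<^sup>2 \<le> exp ((2 * L + 1) * t) * ((norm (z 0))\<^sup>2 + e\<^sup>2 * t)"
proof -
  define k where "k = 2 * L + 1"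
  define V where "V = (\<lambda>s. e\<^sup>2 * s - exp (- k * s) * (z s \<bullet> z s))"
  define V' where "V' = (\<lambda>s. e\<^sup>2 - exp (- k * s) * (2 * (z s \<bullet> z' s) - k * (z s \<bullet> z s)))"
  have derV: "(V has_real_derivative V' s) (at s within {0..t})" if s: "s \<in> {0..t}" for s
  proof -
    have dz: "(z has_derivative (\<lambda>h. h *\<^sub>R z' s)) (at s within {0..t})"
      using der[of s] s assms(5) has_vector_derivative_within_subset[of z "z' s" s "{0..b}" "{0..t}"]
      by (auto simp: has_vector_derivative_def)
    have "((\<lambda>s. z s \<bullet> z s) has_derivative (\<lambda>h. z s \<bullet> (h *\<^sub>R z' s) + (h *\<^sub>R z' s) \<bullet> z s)) (at s within {0..t})"
      by (rule has_derivative_inner[OF dz dz])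
    then have "((\<lambda>s. z s \<bullet> z s) has_real_derivative (2 * (z s \<bullet> z' s))) (at s within {0..t})"
      by (rule has_derivative_imp_has_field_derivative) (simp add: inner_commute)
    then show ?thesis
      unfolding V_def V'_def by (auto intro!: derivative_eq_intros simp: algebra_simps)
  qed
  have nonneg: "0 \<le> V' s" if s: "s \<in> {0..t}" for s
  proof -
    have "z s \<bullet> z' s \<le> norm (z s) * norm (z' s)"
      by (rule norm_cauchy_schwarz)
    also have "\<dots> \<le> norm (z s) * (L * norm (z s) + e)"
      using bound[of s] s assms(5) by (intro mult_left_mono) auto
    finally have "2 * (z s \<bullet> z' s) - k * (z s \<bullet> z s) \<le> 2 * e * norm (z s) - (norm (z s))\<^sup>2"
      by (simp add: k_def dot_square_norm algebra_simps power2_eq_square)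
    also have "\<dots> \<le> e\<^sup>2"
      using zero_le_power2[of "e - norm (z s)"] by (simp add: power2_diff algebra_simps)
    finally have *: "2 * (z s \<bullet> z' s) - k * (z s \<bullet> z s) \<le> e\<^sup>2" .
    have "exp (- k * s) * (2 * (z s \<bullet> z' s) - k * (z s \<bullet> z s)) \<le> exp (- k * s) * e\<^sup>2"
      using * by (intro mult_left_mono) auto
    also have "\<dots> \<le> 1 * e\<^sup>2"
      using s \<open>0 \<le> L\<close> by (intro mult_right_mono) (auto simp: k_def intro!: mult_nonpos_nonneg)
    finally show ?thesis by (simp add: V'_def)
  qed
  have "V 0 \<le> V t"
    by (rule nondecreasing_within[of 0 t V V']) (use assms(5) derV nonneg in auto)
  then have *: "exp (- k * t) * (norm (z t))\<^sup>2 \<le> (norm (z 0))\<^sup>2 + e\<^sup>2 * t"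
    by (simp add: V_def dot_square_norm)
  have "(norm (z t))\<^sup>2 = exp (k * t) * (exp (- k * t) * (norm (z t))\<^sup>2)"
    by (simp add: exp_minus)
  also have "\<dots> \<le> exp (k * t) * ((norm (z 0))\<^sup>2 + e\<^sup>2 * t)"
    using * by (intro mult_left_mono) auto
  finally show ?thesis by (simp add: k_def)
qed

lemma norm_exp_bound:
  fixes z :: "real \<Rightarrow> 'a::real_inner"
  assumes der: "\<And>t. t \<in> {0..b} \<Longrightarrow> (z has_vector_derivative z' t) (at t within {0..b})"
    and bound: "\<And>t. t \<in> {0..b} \<Longrightarrow> norm (z' t) \<le> L * norm (z t)"
    and "0 \<le> L" "t \<in> {0..b}"
  shows "norm (z t) \<le> exp ((L + 1) * t) * norm (z 0)"
proof (rule power2_le_imp_le)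
  have "(norm (z t))\<^sup>2 \<le> exp ((2 * L + 1) * t) * ((norm (z 0))\<^sup>2 + 0\<^sup>2 * t)"
    by (rule norm_growth_bound[where b=b and z'=z']) (use assms in auto)
  \<comment> \<open>The exponent is rounded up from \<open>2 L + 1\<close> to
    \<open>2 (L + 1)\<close>, so that the right-hand side is the square of the claimed
    bound.\<close>
  also have "\<dots> \<le> exp ((2 * L + 2) * t) * (norm (z 0))\<^sup>2"
    using assms(4) by (auto intro!: mult_right_mono)
  also have "\<dots> = (exp ((L + 1) * t) * norm (z 0))\<^sup>2"
    by (simp add: power_mult_distrib exp_double[symmetric] algebra_simps)
  finally show "(norm (z t))\<^sup>2 \<le> (exp ((L + 1) * t) * norm (z 0))\<^sup>2" .
qed auto

text \<open>The Picard operator acts on \<open>y t = exp (- 2 L t) z t\<close>, so that it is a contraction of the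
  bounded continuous functions on the whole half-line.\<close>

lemma global_lipschitz_ivp:
  fixes F :: "real \<Rightarrow> 'a::banach \<Rightarrow> 'a"
  assumes cont: "continuous_on UNIV (\<lambda>(t, z). F t z)"
    and lip: "\<And>t y z. norm (F t y - F t z) \<le> L * norm (y - z)" and "0 < L"
    and bd: "\<And>t. norm (F t 0) \<le> B"
  shows "\<exists>z. z 0 = \<xi> \<and> continuous_on UNIV z \<and> (\<forall>t\<ge>0. (z has_vector_derivative F t (z t)) (at t within {0..}))"
proof -
  define k where "k = 2 * L"
  have k: "0 < k" using \<open>0 < L\<close> by (simp add: k_def)
  define z where "z = (\<lambda>(y :: real \<Rightarrow>\<^sub>C 'a) s. exp (k * s) *\<^sub>R y s)"
  define I where "I = (\<lambda>y t. \<xi> + integral {0..t} (\<lambda>s. F s (z y s)))"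
  \<comment> \<open>For negative times the operator is frozen at its value \<xi> at 0, so that it
    acts on bounded continuous functions on the whole line.\<close>
  define A where "A = (\<lambda>y t. exp (- k * max 0 t) *\<^sub>R I y (max 0 t))"
  have contF: "continuous_on S (\<lambda>s. F s (f s))" if "continuous_on S f" for f S
    using continuous_on_compose2[OF cont, of S "\<lambda>s. (s, f s)"] that
    by (simp add: continuous_on_Pair)
  have contz: "continuous_on S (z y)" for y S
    unfolding z_def by (intro continuous_intros continuous_on_apply_bcontfun)
  have derI: "(I y has_vector_derivative F t (z y t)) (at t within {0..b})" if "t \<in> {0..b}" for y t b
    unfolding I_def
    using integral_has_vector_derivative[OF contF[OF contz], of t 0 b y] that
    by (auto intro!: derivative_eq_intros)
  have contI: "continuous_on {0..} (I y)" for y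
  proof -
    have "continuous (at t within {0..}) (I y)" if "t \<ge> 0" for t
    proof -
      have "continuous (at t within {0..t+1}) (I y)"
        using derI[of t "t+1" y] that has_vector_derivative_continuous by auto
      moreover have "at t within {0..t+1} = at t within {0..}"
        by (rule at_within_nhd[of _ "{..<t+1}"]) auto
      ultimately show ?thesis by simp
    qed
    then show ?thesis by (auto simp: continuous_on_eq_continuous_within)
  qed
  have contA: "continuous_on UNIV (A y)" for y
    unfolding A_def
    by (intro continuous_intros continuous_on_compose2[OF contI]) auto
  \<comment> \<open>The gain of the exponential weight: integrating an error of size
    \<open>M exp (k s)\<close> costs only the factor \<open>1 / k\<close>. With
    \<open>k = 2 L\<close> the Lipschitz constant turns into the contraction factor 1/2.\<close>
  have int_exp: "exp (- k * t) * integral {0..t} (\<lambda>s. M * exp (k * s)) \<le> M / k" if "t \<ge> 0" "M \<ge> 0" for t M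
  proof -
    have "((\<lambda>s. M * exp (k * s)) has_integral (M * exp (k * t) / k - M * exp (k * 0) / k)) {0..t}"
      by (rule fundamental_theorem_of_calculus)
        (use k that in \<open>auto intro!: derivative_eq_intros
          simp: has_real_derivative_iff_has_vector_derivative[symmetric]\<close>)
    then have "integral {0..t} (\<lambda>s. M * exp (k * s)) \<le> M * exp (k * t) / k"
      using k that by (subst integral_unique) auto
    then have "exp (- k * t) * integral {0..t} (\<lambda>s. M * exp (k * s)) \<le> exp (- k * t) * (M * exp (k * t) / k)"
      by (intro mult_left_mono) auto
    also have "\<dots> = M / k" by (simp add: exp_minus)
    finally show ?thesis .
  qed
  have bdA: "norm (A y t) \<le> norm \<xi> + (B + L * norm y) / k" for y t
  proof -
    define r where "r = max 0 t"
    have r: "r \<ge> 0" by (simp add: r_def)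
    have B: "0 \<le> B" using bd[of 0] norm_ge_zero order_trans by blast
    have "norm (integral {0..r} (\<lambda>s. F s (z y s))) \<le> integral {0..r} (\<lambda>s. (B + L * norm y) * exp (k * s))"
    proof (rule integral_norm_bound_integral)
      fix s assume s: "s \<in> {0..r}"
      have "norm (F s (z y s)) \<le> norm (F s (z y s) - F s 0) + norm (F s 0)"
        by (metis diff_add_cancel norm_triangle_ineq)
      also have "\<dots> \<le> L * norm (z y s) + B"
        using lip[of s "z y s" 0] bd[of s] by simp
      also have "norm (z y s) \<le> exp (k * s) * norm y"
        by (simp add: z_def norm_bounded)
      also have "B \<le> B * exp (k * s)"
        using B s k by (simp add: mult_le_cancel_left1)
      finally show "norm (F s (z y s)) \<le> (B + L * norm y) * exp (k * s)"
        using \<open>0 < L\<close> by (simp add: algebra_simps)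
    qed (auto intro!: integrable_continuous_real continuous_intros contF contz)
    then have "exp (- k * r) * norm (integral {0..r} (\<lambda>s. F s (z y s)))
        \<le> exp (- k * r) * integral {0..r} (\<lambda>s. (B + L * norm y) * exp (k * s))"
      by (intro mult_left_mono) auto
    also have "\<dots> \<le> (B + L * norm y) / k"
      using r B \<open>0 < L\<close> by (intro int_exp) auto
    finally have *: "exp (- k * r) * norm (integral {0..r} (\<lambda>s. F s (z y s))) \<le> (B + L * norm y) / k" .
    have "norm (A y t) \<le> exp (- k * r) * (norm \<xi> + norm (integral {0..r} (\<lambda>s. F s (z y s))))"
      unfolding A_def I_def r_def[symmetric] by (simp add: norm_triangle_ineq)
    also have "\<dots> \<le> norm \<xi> + exp (- k * r) * norm (integral {0..r} (\<lambda>s. F s (z y s)))"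
      using k r by (simp add: distrib_left mult_left_le_one_le)
    finally show ?thesis using * by simp
  qed
  have A_in: "A y \<in> bcontfun" for y
    by (rule bcontfun_normI[OF contA bdA])
  define \<Phi> where "\<Phi> = (\<lambda>y. Bcontfun (A y))"
  have Phi: "\<Phi> y t = A y t" for y t
    unfolding \<Phi>_def using A_in by (simp add: Bcontfun_inverse)
  have "\<exists>!y. \<Phi> y = y"
  proof (rule banach_fix_type[where c="1/2"])
    show "\<forall>y1 y2. dist (\<Phi> y1) (\<Phi> y2) \<le> 1 / 2 * dist y1 y2"
    proof (intro allI dist_bound)
      fix y1 y2 :: "real \<Rightarrow>\<^sub>C 'a" and t :: real
      define r where "r = max 0 t"
      have r: "r \<ge> 0" by (simp add: r_def)
      have "norm (integral {0..r} (\<lambda>s. F s (z y1 s) - F s (z y2 s)))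
          \<le> integral {0..r} (\<lambda>s. (L * dist y1 y2) * exp (k * s))"
      proof (rule integral_norm_bound_integral)
        fix s assume s: "s \<in> {0..r}"
        have "norm (F s (z y1 s) - F s (z y2 s)) \<le> L * norm (z y1 s - z y2 s)"
          by (rule lip)
        also have "norm (z y1 s - z y2 s) = exp (k * s) * dist (y1 s) (y2 s)"
          by (simp add: z_def scaleR_diff_right[symmetric] dist_norm)
        also have "dist (y1 s) (y2 s) \<le> dist y1 y2" by (rule dist_bounded)
        finally show "norm (F s (z y1 s) - F s (z y2 s)) \<le> (L * dist y1 y2) * exp (k * s)"
          using \<open>0 < L\<close> by (simp add: algebra_simps)
      qed (auto intro!: integrable_continuous_real continuous_intros contF contz)
      then have "exp (- k * r) * norm (integral {0..r} (\<lambda>s. F s (z y1 s) - F s (z y2 s)))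
        \<le> exp (- k * r) * integral {0..r} (\<lambda>s. (L * dist y1 y2) * exp (k * s))"
        by (intro mult_left_mono) auto
      also have "\<dots> \<le> (L * dist y1 y2) / k"
        using r \<open>0 < L\<close> by (intro int_exp) auto
      finally have "exp (- k * r) * norm (integral {0..r} (\<lambda>s. F s (z y1 s) - F s (z y2 s))) \<le> 1/2 * dist y1 y2"
        using \<open>0 < L\<close> by (simp add: k_def)
      moreover have "integral {0..r} (\<lambda>s. F s (z y1 s) - F s (z y2 s)) = I y1 r - I y2 r"
        unfolding I_def
        by (subst Henstock_Kurzweil_Integration.integral_diff) (auto intro!: integrable_continuous_real contF contz)
      ultimately show "dist (\<Phi> y1 t) (\<Phi> y2 t) \<le> 1 / 2 * dist y1 y2"
        by (simp add: Phi A_def r_def dist_norm scaleR_diff_right[symmetric])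
    qed
  qed auto
  then obtain y where y: "\<Phi> y = y" by blast
  have zI: "z y t = I y t" if "t \<ge> 0" for t
  proof -
    have "z y t = exp (k * t) *\<^sub>R A y t"
      using Phi[of y t] y by (simp add: z_def)
    then show ?thesis using that by (simp add: A_def exp_minus)
  qed
  have "(z y has_vector_derivative F t (z y t)) (at t within {0..})" if "t \<ge> 0" for t
  proof -
    have "(z y has_vector_derivative F t (z y t)) (at t within {0..t+1})"
      by (rule has_vector_derivative_transform[OF _ _ derI]) (use that zI in auto)
    moreover have "at t within {0..t+1} = at t within {0..}"
      by (rule at_within_nhd[of _ "{..<t+1}"]) auto
    ultimately show ?thesis by simp
  qed
  moreover have "z y 0 = \<xi>" using zI[of 0] by (simp add: I_def)
  ultimately show ?thesis using contz by blast
qed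

section \<open>Oscillation of the linear equation\<close>

text \<open>Encoded as a first-order system for the pair \<open>(u, u')\<close> with one-sided
  derivatives at the ends, so that it restricts to subintervals and \<open>a\<close> enters the
  comparison arguments through inequalities only.\<close>

definition damped_sol ::
    "real \<Rightarrow> real \<Rightarrow> (real \<Rightarrow> real) \<Rightarrow> (real \<Rightarrow> real) \<Rightarrow> (real \<Rightarrow> real) \<Rightarrow> bool" where
  "damped_sol T c a u u' \<longleftrightarrow>
     (\<forall>t\<in>{0..T}. (u has_real_derivative u' t) (at t within {0..T}) \<and>
                 (u' has_real_derivative - c * u' t - a t * u t) (at t within {0..T}))"

lemma damped_sol_cont:
  assumes "damped_sol T c a u u'"
  shows "continuous_on {0..T} u" "continuous_on {0..T} u'"
  using assms unfolding damped_sol_def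
  by (meson DERIV_continuous continuous_on_eq_continuous_within)+

lemma damped_sol_subset:
  assumes "damped_sol T c a u u'" "S \<subseteq> {0..T}" "t \<in> S"
  shows "(u has_real_derivative u' t) (at t within S)"
    and "(u' has_real_derivative - c * u' t - a t * u t) (at t within S)"
  using assms unfolding damped_sol_def by (meson DERIV_subset subsetD)+

lemma damped_sol_lincomb:
  assumes "damped_sol T c a u u'" "damped_sol T c a v v'"
  shows "damped_sol T c a (\<lambda>t. p * u t + q * v t) (\<lambda>t. p * u' t + q * v' t)"
  using assms unfolding damped_sol_def
  by (auto intro!: derivative_eq_intros simp: algebra_simps)

text \<open>The weight \<open>exp (c t / 2)\<close> cancels the first-order term and moves
  \<open>c^2 / 4\<close> into the coefficient, which brings the equation into the form to which
  Sturm comparison applies.\<close>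

lemma damped_sol_remove_damping:
  assumes "damped_sol T c a u u'"
  shows "damped_sol T 0 (\<lambda>t. a t - c\<^sup>2 / 4)
    (\<lambda>t. exp (c / 2 * t) * u t) (\<lambda>t. exp (c / 2 * t) * (u' t + c / 2 * u t))"
  unfolding damped_sol_def
proof (intro ballI conjI)
  fix t assume t: "t \<in> {0..T}"
  note der = damped_sol_subset[OF assms order_refl t]
  show "((\<lambda>t. exp (c / 2 * t) * u t) has_real_derivative exp (c / 2 * t) * (u' t + c / 2 * u t))
      (at t within {0..T})"
    by (rule derivative_eq_intros der refl)+ (simp add: field_simps)
  show "((\<lambda>t. exp (c / 2 * t) * (u' t + c / 2 * u t)) has_real_derivative
      - 0 * (exp (c / 2 * t) * (u' t + c / 2 * u t)) - (a t - c\<^sup>2 / 4) * (exp (c / 2 * t) * u t))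
      (at t within {0..T})"
    by (rule derivative_eq_intros der refl)+ (simp add: field_simps power2_eq_square)
qed

text \<open>Liouville's formula: multiplied by \<open>exp (c t)\<close>, the Wronskian has
  derivative zero.\<close>

lemma damped_sol_wronskian:
  assumes u: "damped_sol T c a u u'" and v: "damped_sol T c a v v'" and t: "t \<in> {0..T}"
  shows "u t * v' t - v t * u' t = exp (- c * t) * (u 0 * v' 0 - v 0 * u' 0)"
proof -
  define f where "f = (\<lambda>t. exp (c * t) * (u t * v' t - v t * u' t))"
  have "(f has_derivative (\<lambda>h. 0)) (at s within {0..T})" if s: "s \<in> {0..T}" for s
  proof -
    note der = damped_sol_subset[OF u order_refl s] damped_sol_subset[OF v order_refl s]
    have "(f has_real_derivative 0) (at s within {0..T})"
      unfolding f_def by (rule derivative_eq_intros der refl)+ (simp add: algebra_simps)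
    then show ?thesis
      unfolding has_field_derivative_def by (rule has_derivative_eq_rhs) auto
  qed
  then obtain k where "\<forall>s\<in>{0..T}. f s = k"
    using has_derivative_zero_constant[of "{0..T}" f] by auto
  then have "f t = f 0" using t by auto
  then have "exp (- c * t) * f t = exp (- c * t) * f 0" by simp
  then show ?thesis by (simp add: f_def exp_minus field_simps)
qed

lemma sign_const:
  fixes f :: "real \<Rightarrow> real"
  assumes cont: "continuous_on {a..b} f" and nz: "\<And>t. t \<in> {a<..<b} \<Longrightarrow> f t \<noteq> 0"
  shows "(\<forall>t\<in>{a..b}. 0 \<le> f t) \<or> (\<forall>t\<in>{a..b}. f t \<le> 0)"
proof (rule ccontr)
  assume "\<not> ?thesis"
  then obtain x y where x: "x \<in> {a..b}" "f x < 0" and y: "y \<in> {a..b}" "0 < f y"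
    by (auto simp: not_le)
  have sub: "{min x y..max x y} \<subseteq> {a..b}" using x y by auto
  obtain t where t: "min x y \<le> t" "t \<le> max x y" "f t = 0"
  proof (cases "x \<le> y")
    case True
    then show ?thesis
      using IVT'[of f x 0 y] x y that continuous_on_subset[OF cont sub] by auto
  next
    case False
    then show ?thesis
      using IVT2'[of f x 0 y] x y that continuous_on_subset[OF cont sub] by auto
  qed
  moreover have "t \<noteq> x" "t \<noteq> y" using t x y by auto
  ultimately show False using nz[of t] x y by (auto simp: min_def max_def split: if_splits)
qed

section \<open>Sturm comparison with a sine of half-period T\<close>

lemma sin_half_period_pos:
  fixes x T :: real
  assumes "0 < x" "x < T"
  shows "0 < sin (pi / T * x)"
proof (rule sin_gt_zero)
  have "pi / T * x < pi / T * T" using assms by (intro mult_strict_left_mono) auto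
  then show "pi / T * x < pi" using assms by simp
qed (use assms in auto)

text \<open>Sturm comparison with \<open>s'' = - (\<pi> / T)\<^sup>2 s\<close>, where \<open>s > 0\<close> on \<open>[t1, t2]\<close>: with
  \<open>W = v' s - v s'\<close>, the function \<open>(v / s) W\<close> is nondecreasing and vanishes at both zeros.\<close>

lemma zeros_apart:
  assumes v: "damped_sol T 0 q v v'" and q: "\<And>t. t \<in> {0..T} \<Longrightarrow> q t \<le> (pi / T)\<^sup>2"
    and t: "0 \<le> t1" "t1 < t2" "t2 \<le> T" "t2 - t1 < T" and z: "v t1 = 0" "v t2 = 0"
  shows "v' t1 = 0"
proof (rule ccontr)
  assume nz: "v' t1 \<noteq> 0"
  have T: "T > 0" using t by simp
  \<comment> \<open>The phase centres \<open>[t1, t2]\<close> in the interval of length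
    \<open>T\<close> on which the sine is positive; the slack is split evenly between both
    sides.\<close>
  define m where "m = t1 - (T - (t2 - t1)) / 2"
  define k where "k = pi / T"
  define s where "s = (\<lambda>t. sin (k * (t - m)))"
  define s' where "s' = (\<lambda>t. k * cos (k * (t - m)))"
  define W where "W = (\<lambda>t. v' t * s t - v t * s' t)"
  \<comment> \<open>Picone's identity: \<open>(v / s)' = W / s^2\<close> and
    \<open>W' = (k^2 - q) v s\<close> exhibit \<open>E'\<close> as a sum of two nonnegative
    terms.\<close>
  define E where "E = (\<lambda>t. v t / s t * W t)"
  define E' where "E' = (\<lambda>t. (W t / s t)\<^sup>2 + (k\<^sup>2 - q t) * (v t)\<^sup>2)"
  have s_pos: "s t > 0" if "t \<in> {t1..t2}" for t
  proof -
    have "0 < t - m" "t - m < T" using that t by (auto simp: m_def field_simps)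
    then show ?thesis unfolding s_def k_def by (rule sin_half_period_pos)
  qed
  have derE: "(E has_real_derivative E' t) (at t within {t1..t2})" if tt: "t \<in> {t1..t2}" for t
  proof -
    have sub: "{t1..t2} \<subseteq> {0..T}" using t by auto
    note der = damped_sol_subset[OF v sub tt]
    have s: "(s has_real_derivative s' t) (at t within {t1..t2})"
      unfolding s_def s'_def by (auto intro!: derivative_eq_intros)
    have s': "(s' has_real_derivative - k\<^sup>2 * s t) (at t within {t1..t2})"
      unfolding s_def s'_def by (auto intro!: derivative_eq_intros simp: power2_eq_square)
    have W: "(W has_real_derivative (k\<^sup>2 - q t) * v t * s t) (at t within {t1..t2})"
      unfolding W_def by (rule derivative_eq_intros der s s' refl)+ (simp add: algebra_simps)
    have "(E has_real_derivative
        (v' t * s t - v t * s' t) / (s t * s t) * W t + (k\<^sup>2 - q t) * v t * s t * (v t / s t))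
        (at t within {t1..t2})"
      unfolding E_def using s_pos[OF tt] by (intro DERIV_mult DERIV_divide der s W) auto
    moreover have "v' t * s t - v t * s' t = W t" by (simp add: W_def)
    ultimately show ?thesis
      using s_pos[OF tt] by (simp add: E'_def power2_eq_square mult.assoc)
  qed
  have E'_nonneg: "0 \<le> E' t" if "t \<in> {t1..t2}" for t
    using q[of t] t that unfolding E'_def k_def by auto
  \<comment> \<open>At \<open>t1\<close> the function \<open>v\<close> vanishes and
    \<open>W / s\<close> equals \<open>v'\<close>, so \<open>E\<close> leaves the value 0 strictly;
    monotonicity alone would not exclude that \<open>E\<close> stays 0.\<close>
  have "E' t1 > 0"
    using s_pos[of t1] t nz z by (simp add: E'_def W_def)
  then obtain d where d: "d > 0" "\<And>h. h > 0 \<Longrightarrow> t1 + h \<in> {t1..t2} \<Longrightarrow> h < d \<Longrightarrow> E t1 < E (t1 + h)"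
    using has_real_derivative_pos_inc_right[OF derE[of t1]] t by auto
  define h where "h = min (d / 2) (t2 - t1)"
  have h: "h > 0" "h < d" "t1 + h \<in> {t1..t2}" using d t by (auto simp: h_def)
  have "E (t1 + h) \<le> E t2"
  proof (rule nondecreasing_within[of "t1 + h" t2 E E'])
    fix t assume tt: "t \<in> {t1 + h..t2}"
    show "(E has_real_derivative E' t) (at t within {t1 + h..t2})"
      by (rule DERIV_subset[OF derE]) (use tt h in auto)
  qed (use h E'_nonneg in auto)
  moreover have "E t1 = 0" "E t2 = 0" using z by (auto simp: E_def)
  ultimately show False using d(2)[of h] h by auto
qed

text \<open>A zero would be unique in \<open>(0, T)\<close> by \<open>zeros_apart\<close>, so that \<open>v\<close> cannot change sign there;
  it would then be an extremum and \<open>v'\<close> would vanish as well.\<close>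

lemma positive_multiplier_nonvanishing:
  assumes v: "damped_sol T 0 q v v'" and q: "\<And>t. t \<in> {0..T} \<Longrightarrow> q t \<le> (pi / T)\<^sup>2"
    and nontriv: "\<And>t. t \<in> {0..T} \<Longrightarrow> v t \<noteq> 0 \<or> v' t \<noteq> 0"
    and T: "T > 0" and m: "v T = \<sigma> * v 0" "v' T = \<sigma> * v' 0" "\<sigma> > 0"
    and t0: "t0 \<in> {0..T}"
  shows "v t0 \<noteq> 0"
proof
  assume z: "v t0 = 0"
  have uniq: False if "0 \<le> t1" "t1 < t2" "t2 \<le> T" "t2 - t1 < T" "v t1 = 0" "v t2 = 0" for t1 t2
    using zeros_apart[OF v q that] nontriv[of t1] that by auto
  note cont = damped_sol_cont[OF v]
  have der: "(v has_real_derivative v' t) (at t within {0..T})" if "t \<in> {0..T}" for t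
    using v that by (auto simp: damped_sol_def)
  \<comment> \<open>A \<open>v\<close> of one sign is impossible. An interior zero would be an
    extremum. If the zero is an end point, both ends are zeros, \<open>v' 0\<close> and
    \<open>v' T\<close> share their sign because \<sigma> is positive, and next to one of the ends
    \<open>v\<close> takes the forbidden sign.\<close>
  have deriv_sign: False if sg: "e = 1 \<or> e = -1" "\<And>t. t \<in> {0..T} \<Longrightarrow> 0 \<le> e * v t" for e
  proof (cases "0 < t0 \<and> t0 < T")
    case True
    have "(v has_real_derivative v' t0) (at t0)"
      using der[OF t0] True by (simp add: at_within_Icc_at)
    then have "((\<lambda>t. e * v t) has_real_derivative e * v' t0) (at t0)"
      by (rule DERIV_cmult)
    moreover have "\<forall>y. \<bar>t0 - y\<bar> < min t0 (T - t0) \<longrightarrow> e * v t0 \<le> e * v y"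
      using sg(2) z by (auto simp: abs_if split: if_splits)
    ultimately have "e * v' t0 = 0"
      using True by (intro DERIV_local_min[where d="min t0 (T - t0)"]) auto
    then show False using nontriv[OF t0] z sg(1) by auto
  next
    case False
    then have z0: "v 0 = 0" "v T = 0" using z t0 m by auto
    have de: "((\<lambda>t. e * v t) has_real_derivative e * v' t) (at t within {0..T})" if "t \<in> {0..T}" for t
      using der[OF that] by (rule DERIV_cmult)
    have nz: "e * v' 0 \<noteq> 0" using nontriv[of 0] z0 T sg(1) by auto
    show False
    proof (cases "e * v' 0 < 0")
      case True
      obtain d where d: "d > 0" "\<And>h. h > 0 \<Longrightarrow> 0 + h \<in> {0..T} \<Longrightarrow> h < d \<Longrightarrow> e * v (0 + h) < e * v 0"
        using has_real_derivative_neg_dec_right[OF de[of 0] True] T by auto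
      have "e * v (0 + min (d / 2) T) < e * v 0" by (rule d(2)) (use d T in auto)
      then show False using sg(2)[of "min (d / 2) T"] d T z0 by auto
    next
      case False
      then have "0 < e * v' 0" using nz by linarith
      then have "0 < \<sigma> * (e * v' 0)" using m(3) by (rule mult_pos_pos[rotated])
      then have pos: "e * v' T > 0" using m(2) by (simp add: ac_simps)
      obtain d where d: "d > 0" "\<And>h. h > 0 \<Longrightarrow> T - h \<in> {0..T} \<Longrightarrow> h < d \<Longrightarrow> e * v (T - h) < e * v T"
        using has_real_derivative_pos_inc_left[OF de[of T] pos] T by auto
      have "e * v (T - min (d / 2) T) < e * v T" by (rule d(2)) (use d T in auto)
      then show False using sg(2)[of "T - min (d / 2) T"] d T z0 by auto
    qed
  qed
  have sub: "continuous_on {0..t0} v" "continuous_on {t0..T} v"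
    using t0 by (auto intro!: continuous_on_subset[OF cont(1)])
  show False
  proof (cases "0 < t0 \<and> t0 < T")
    case True
    \<comment> \<open>Any second zero would be closer than \<open>T\<close> to the interior zero
      \<open>t0\<close>. So \<open>v\<close> keeps one sign on each side of \<open>t0\<close>, and
      since \<open>v 0\<close> and \<open>v T\<close> have equal signs, it keeps one sign on the
      whole period.\<close>
    have "v 0 \<noteq> 0" using uniq[of 0 t0] True z by auto
    have L: "(\<forall>t\<in>{0..t0}. 0 \<le> v t) \<or> (\<forall>t\<in>{0..t0}. v t \<le> 0)"
      by (rule sign_const[OF sub(1)]) (use uniq[of _ t0] True z in force)
    have R: "(\<forall>t\<in>{t0..T}. 0 \<le> v t) \<or> (\<forall>t\<in>{t0..T}. v t \<le> 0)"
      by (rule sign_const[OF sub(2)]) (use uniq[of t0] True z in force)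
    show False
    proof (cases "v 0 > 0")
      case True
      then have "v T > 0" using m by simp
      have "\<forall>t\<in>{0..T}. 0 \<le> v t"
        using L R True \<open>v T > 0\<close> t0 by (smt (verit) atLeastAtMost_iff)
      then show False using deriv_sign[of 1] by simp
    next
      case False
      then have "v 0 < 0" "v T < 0" using m \<open>v 0 \<noteq> 0\<close> by (auto simp: mult_pos_neg)
      have "\<forall>t\<in>{0..T}. 0 \<le> - v t"
        using L R \<open>v 0 < 0\<close> \<open>v T < 0\<close> t0 by (smt (verit) atLeastAtMost_iff)
      then show False using deriv_sign[of "-1"] by simp
    qed
  next
    case False
    then have z0: "v 0 = 0" "v T = 0" using z t0 m by auto
    have "(\<forall>t\<in>{0..T}. 0 \<le> v t) \<or> (\<forall>t\<in>{0..T}. v t \<le> 0)"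
      by (rule sign_const[OF cont(1)]) (use uniq[of 0] z0 in force)
    then show False using deriv_sign[of 1] deriv_sign[of "-1"] by auto
  qed
qed

text \<open>\<open>u' / u + c ln \<bar>u\<bar> + \<integral>\<beta>\<close> is nonincreasing by the Riccati equation of \<open>u' / u\<close>.\<close>

lemma positive_multiplier_bound:
  assumes u: "damped_sol T c a u u'" and a: "\<And>t. t \<in> {0..T} \<Longrightarrow> a t \<le> (pi / T)\<^sup>2 + c\<^sup>2 / 4"
    and nontriv: "\<And>t. t \<in> {0..T} \<Longrightarrow> u t \<noteq> 0 \<or> u' t \<noteq> 0"
    and T: "T > 0" and c: "c > 0" and m: "u T = r * u 0" "u' T = r * u' 0" "r > 0"
    and b: "continuous_on {0..T} \<beta>" "\<And>t. t \<in> {0..T} \<Longrightarrow> \<beta> t \<le> a t"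
  shows "r \<le> exp (- integral {0..T} \<beta> / c)"
proof -
  have nz: "u t \<noteq> 0" if t: "t \<in> {0..T}" for t
  proof -
    have "exp (c / 2 * t) * u t \<noteq> 0"
    proof (rule positive_multiplier_nonvanishing[OF damped_sol_remove_damping[OF u] _ _ T _ _ _ t])
      show "exp (c / 2 * T) * u T = (exp (c / 2 * T) * r) * (exp (c / 2 * 0) * u 0)"
        "exp (c / 2 * T) * (u' T + c / 2 * u T) =
          (exp (c / 2 * T) * r) * (exp (c / 2 * 0) * (u' 0 + c / 2 * u 0))"
        using m by (auto simp: algebra_simps)
    qed (use a nontriv m(3) in force)+
    then show ?thesis by simp
  qed
  \<comment> \<open>With \<open>y = u' / u\<close> the Riccati equation is
    \<open>y' = - y^2 - c y - a\<close>; \<open>G\<close> is the negative of the nonincreasing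
    quantity. The logarithm of \<open>u^2\<close> is differentiable whatever the sign of
    \<open>u\<close>.\<close>
  define G where "G = (\<lambda>t. - (u' t / u t) - c / 2 * ln ((u t)\<^sup>2) - integral {0..t} \<beta>)"
  have "G 0 \<le> G T"
  proof (rule nondecreasing_within[of 0 T G "\<lambda>t. (u' t / u t)\<^sup>2 + (a t - \<beta> t)"])
    fix t assume t: "t \<in> {0..T}"
    note der = damped_sol_subset[OF u order_refl t]
    have i: "((\<lambda>t. integral {0..t} \<beta>) has_real_derivative \<beta> t) (at t within {0..T})"
      using integral_has_vector_derivative[OF b(1) t]
      by (simp add: has_real_derivative_iff_has_vector_derivative)
    have l: "((\<lambda>t. ln ((u t)\<^sup>2)) has_real_derivative 2 * (u' t / u t)) (at t within {0..T})"
    proof -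
      have "((\<lambda>t. ln ((u t)\<^sup>2)) has_real_derivative inverse ((u t)\<^sup>2) * (2 * u t * u' t)) (at t within {0..T})"
        using nz[OF t]
        by (intro DERIV_chain2[OF DERIV_ln]) (auto intro!: derivative_eq_intros der)
      then show ?thesis using nz[OF t] by (simp add: field_simps power2_eq_square)
    qed
    show "(G has_real_derivative (u' t / u t)\<^sup>2 + (a t - \<beta> t)) (at t within {0..T})"
    proof -
      have "(G has_real_derivative
          - (((- c * u' t - a t * u t) * u t - u' t * u' t) / (u t * u t)) - c / 2 * (2 * (u' t / u t)) - \<beta> t)
          (at t within {0..T})"
        unfolding G_def by (intro DERIV_diff DERIV_minus DERIV_divide DERIV_cmult der i l nz[OF t])
      then show ?thesis
        by (rule DERIV_cong) (use nz[OF t] in \<open>simp add: field_simps power2_eq_square\<close>)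
    qed
  qed (use T b in auto)
  moreover have "G 0 = - (u' 0 / u 0) - c / 2 * ln ((u 0)\<^sup>2)"
    by (simp add: G_def)
  \<comment> \<open>The multiplier relation makes \<open>u' / u\<close> agree at both ends, so that
    \<open>G T - G 0\<close> retains only \<open>c ln r\<close> and the integral of \<beta>.\<close>
  moreover have "G T = - (u' 0 / u 0) - (c * ln r + c / 2 * ln ((u 0)\<^sup>2)) - integral {0..T} \<beta>"
  proof -
    have "u' T / u T = u' 0 / u 0" using m by simp
    moreover have "ln ((u T)\<^sup>2) = 2 * ln r + ln ((u 0)\<^sup>2)"
      using m nz[of 0] T by (simp add: power_mult_distrib ln_mult ln_realpow)
    ultimately show ?thesis by (simp add: G_def distrib_left add_divide_distrib)
  qed
  ultimately have "c * ln r \<le> - integral {0..T} \<beta>" by linarith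
  then have "ln r \<le> - integral {0..T} \<beta> / c" using c by (simp add: field_simps)
  then show ?thesis using m(3) by (metis exp_le_cancel_iff exp_ln)
qed

text \<open>With \<open>s t = sin (\<pi> (t - t0) / T)\<close> for a zero \<open>t0\<close> of \<open>v\<close>, the Wronskian \<open>W\<close> of \<open>v\<close> and \<open>s\<close> is
  monotone with \<open>W t0 = 0\<close> and \<open>W T = - \<sigma> W 0\<close>, hence identically zero if \<open>\<sigma> < - 1\<close>.\<close>

lemma negative_multiplier_bound:
  assumes v: "damped_sol T 0 q v v'" and q: "\<And>t. t \<in> {0..T} \<Longrightarrow> q t \<le> (pi / T)\<^sup>2"
    and nontriv: "\<And>t. t \<in> {0..T} \<Longrightarrow> v t \<noteq> 0 \<or> v' t \<noteq> 0"
    and T: "T > 0" and m: "v T = \<sigma> * v 0" "v' T = \<sigma> * v' 0" "\<sigma> < 0"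
    and strict: "infinite {t\<in>{0..T}. q t < (pi / T)\<^sup>2}"
  shows "- 1 \<le> \<sigma>"
proof (rule ccontr)
  assume sig: "\<not> - 1 \<le> \<sigma>"
  note cont = damped_sol_cont[OF v]
  have uniq: False if "0 \<le> t1" "t1 < t2" "t2 \<le> T" "t2 - t1 < T" "v t1 = 0" "v t2 = 0" for t1 t2
    using zeros_apart[OF v q that] nontriv[of t1] that by auto
  \<comment> \<open>A negative multiplier gives \<open>v 0\<close> and \<open>v T\<close> opposite
    signs unless both vanish, and in that case 0 is chosen; this secures
    \<open>t0 < T\<close>.\<close>
  obtain t0 where t0: "0 \<le> t0" "t0 < T" "v t0 = 0"
  proof (cases "v 0 = 0")
    case True
    then show ?thesis using T that by auto
  next
    case False
    show ?thesis
    proof (cases "v 0 < 0")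
      case True
      then have "v T > 0" using m by (simp add: mult_neg_neg)
      then obtain t where "0 \<le> t" "t \<le> T" "v t = 0"
        using IVT'[of v 0 0 T] True T cont by auto
      then show ?thesis using that[of t] \<open>v T > 0\<close> by (cases "t = T") auto
    next
      case f: False
      then have "v T < 0" using m False by (simp add: mult_neg_pos)
      then obtain t where "0 \<le> t" "t \<le> T" "v t = 0"
        using IVT2'[of v T 0 0] f T cont by auto
      then show ?thesis using that[of t] \<open>v T < 0\<close> by (cases "t = T") auto
    qed
  qed
  define k where "k = pi / T"
  define s where "s = (\<lambda>t. sin (k * (t - t0)))"
  define s' where "s' = (\<lambda>t. k * cos (k * (t - t0)))"
  define W where "W = (\<lambda>t. v' t * s t - v t * s' t)"
  define W' where "W' = (\<lambda>t. (k\<^sup>2 - q t) * (v t * s t))"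
  have kT: "k * (T - t0) = pi - k * t0" using T by (simp add: k_def field_simps)
  \<comment> \<open>The sine is antiperiodic over \<open>T\<close>, that is, it has multiplier -1
    itself. The two negative factors cancel, and \<open>W T\<close> has the sign of
    \<open>W 0\<close>.\<close>
  have sT: "s T = - s 0" "s' T = - s' 0"
    by (auto simp: s_def s'_def kT sin_diff cos_diff)
  have WT: "W T = - \<sigma> * W 0"
    using m by (simp add: W_def sT algebra_simps)
  have derW: "(W has_real_derivative W' t) (at t within {0..T})" if t: "t \<in> {0..T}" for t
  proof -
    note der = damped_sol_subset[OF v order_refl t]
    have s: "(s has_real_derivative s' t) (at t within {0..T})"
      unfolding s_def s'_def by (auto intro!: derivative_eq_intros)
    have s': "(s' has_real_derivative - k\<^sup>2 * s t) (at t within {0..T})"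
      unfolding s_def s'_def by (auto intro!: derivative_eq_intros simp: power2_eq_square)
    show ?thesis
      unfolding W_def W'_def by (rule derivative_eq_intros der s s' refl)+ (simp add: algebra_simps)
  qed
  have s_pos: "s t > 0" if "t0 < t" "t < T + t0" for t
    unfolding s_def k_def using that by (intro sin_half_period_pos) auto
  have s_neg: "s t < 0" if "t < t0" "t0 < T + t" for t
  proof -
    have "0 < sin (k * (t0 - t))" unfolding k_def using that by (intro sin_half_period_pos) auto
    moreover have "k * (t - t0) = - (k * (t0 - t))" by (simp add: algebra_simps)
    ultimately show ?thesis unfolding s_def by (simp only: sin_minus)
  qed
  have nz: "v t \<noteq> 0" if "t \<in> {0<..<T}" "t \<noteq> t0" for t
    using uniq[of t0 t] uniq[of t t0] that t0 by (cases "t < t0") auto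
  \<comment> \<open>If \<open>t0\<close> is interior, \<open>s\<close> and \<open>v\<close> both
    change sign there: \<open>v\<close> has no other zero inside the period and opposite signs at
    its ends. So \<open>v s\<close> never changes sign, and \<open>e\<close> records which sign it
    has.\<close>
  have "\<exists>e\<in>{1, -1}. \<forall>t\<in>{0..T}. 0 \<le> e * (v t * s t)"
  proof -
    have sub: "continuous_on {0..t0} v" "continuous_on {t0..T} v"
      using t0 by (auto intro!: continuous_on_subset[OF cont(1)])
    have L: "(\<forall>t\<in>{0..t0}. 0 \<le> v t) \<or> (\<forall>t\<in>{0..t0}. v t \<le> 0)"
      by (rule sign_const[OF sub(1)]) (use nz t0 in auto)
    have R: "(\<forall>t\<in>{t0..T}. 0 \<le> v t) \<or> (\<forall>t\<in>{t0..T}. v t \<le> 0)"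
      by (rule sign_const[OF sub(2)]) (use nz t0 in auto)
    have sL: "s t \<le> 0" if "t \<in> {0..t0}" for t
      using s_neg[of t] that t0 by (cases "t = t0") (auto simp: s_def)
    have sR: "0 \<le> s t" if "t \<in> {t0..T}" for t
    proof (cases "t = t0 \<or> t = T + t0")
      case True
      then show ?thesis using T by (auto simp: s_def k_def)
    qed (use s_pos[of t] that t0 in auto)
    have v0: "v 0 * v T \<le> 0" using m by (simp add: mult_nonpos_nonneg mult.left_commute)
    show ?thesis
    proof (cases "\<forall>t\<in>{t0..T}. 0 \<le> v t")
      case pos: True
      have "v t \<le> 0" if t: "t \<in> {0..<t0}" for t
      proof (cases "v 0 = 0")
        case True
        then show ?thesis using uniq[of 0 t0] t0 t by auto
      next
        case False
        have "0 \<le> v T" using pos t0 by auto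
        moreover have "v T \<noteq> 0" using m False by auto
        ultimately have "v T > 0" by auto
        then have "v 0 < 0" using v0 False by (simp add: mult_le_0_iff)
        then have "\<not> (\<forall>t\<in>{0..t0}. 0 \<le> v t)" using t0 by force
        then show ?thesis using L t by auto
      qed
      then have "0 \<le> v t * s t" if "t \<in> {0..T}" for t
        using sL[of t] sR[of t] pos that by (cases "t < t0") (auto simp: mult_nonpos_nonpos)
      then show ?thesis by auto
    next
      case neg: False
      then have neg: "\<forall>t\<in>{t0..T}. v t \<le> 0" using R by auto
      have "0 \<le> v t" if t: "t \<in> {0..<t0}" for t
      proof (cases "v 0 = 0")
        case True
        then show ?thesis using uniq[of 0 t0] t0 t by auto
      next
        case False
        have "v T \<le> 0" using neg t0 by auto
        moreover have "v T \<noteq> 0" using m False by auto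
        ultimately have "v T < 0" by auto
        then have "v 0 > 0" using v0 False by (simp add: mult_le_0_iff)
        then have "\<not> (\<forall>t\<in>{0..t0}. v t \<le> 0)" using t0 by force
        then show ?thesis using L t by auto
      qed
      then have "0 \<le> - (v t * s t)" if "t \<in> {0..T}" for t
        using sL[of t] sR[of t] neg that
        by (cases "t < t0") (auto simp: mult_nonpos_nonneg mult_nonneg_nonpos)
      then show ?thesis by auto
    qed
  qed
  then obtain e where "e \<in> {1, -1}" "\<forall>t\<in>{0..T}. 0 \<le> e * (v t * s t)" ..
  then have e: "e = 1 \<or> e = -1" "\<And>t. t \<in> {0..T} \<Longrightarrow> 0 \<le> e * (v t * s t)"
    by blast+
  have mono: "e * W t1 \<le> e * W t2" if "0 \<le> t1" "t1 \<le> t2" "t2 \<le> T" for t1 t2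
  proof (rule nondecreasing_within[of t1 t2 "\<lambda>t. e * W t" "\<lambda>t. e * W' t"])
    fix t assume t: "t \<in> {t1..t2}"
    show "((\<lambda>t. e * W t) has_real_derivative e * W' t) (at t within {t1..t2})"
      by (rule DERIV_cmult, rule DERIV_subset[OF derW]) (use t that in auto)
  next
    fix t assume t: "t \<in> {t1<..<t2}"
    have "0 \<le> (k\<^sup>2 - q t) * (e * (v t * s t))"
      by (rule mult_nonneg_nonneg) (use q[of t] e(2)[of t] t that in \<open>auto simp: k_def\<close>)
    then show "0 \<le> e * W' t" by (simp add: W'_def ac_simps)
  qed (use that in auto)
  \<comment> \<open>Monotonicity through the zero at \<open>t0\<close> gives
    \<open>e * W 0 \<le> 0 \<le> e * W T\<close>, while \<open>W T\<close> is a positive multiple of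
    \<open>W 0\<close>. Both end values are therefore 0, and so is everything between.\<close>
  have "W t0 = 0" using t0 by (simp add: W_def s_def)
  then have W0: "e * W 0 \<le> 0" "0 \<le> e * W T"
    using mono[of 0 t0] mono[of t0 T] t0 by auto
  have "0 \<le> - \<sigma> * (e * W 0)" using W0 WT by (simp add: ac_simps)
  then have "e * W 0 = 0" using W0(1) m(3) by (auto simp: zero_le_mult_iff mult_le_0_iff)
  then have ends: "e * W 0 = 0" "e * W T = 0" using WT by auto
  have Wz: "W t = 0" if "t \<in> {0..T}" for t
    using mono[of 0 t] mono[of t T] that ends e(1) by auto
  \<comment> \<open>Since \<open>W\<close> vanishes, so does \<open>W'\<close>, and
    \<open>v s\<close> can be zero only at 0, \<open>T\<close> and \<open>t0\<close>. Elsewhere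
    \<open>q\<close> must equal \<open>(pi / T)^2\<close>, against \<open>strict\<close>.\<close>
  have qeq: "q t = (pi / T)\<^sup>2" if t: "t \<in> {0<..<T}" "t \<noteq> t0" for t
  proof -
    have "(W has_real_derivative W' t) (at t)"
      using derW[of t] t by (simp add: at_within_Icc_at)
    moreover have "(W has_real_derivative 0) (at t)"
      by (rule has_field_derivative_transform_within_open[of "\<lambda>_. 0" _ _ "{0<..<T}"])
        (use t Wz in auto)
    ultimately have "W' t = 0" by (rule DERIV_unique)
    moreover have "s t \<noteq> 0"
      using s_pos[of t] s_neg[of t] t t0 by (cases "t < t0") auto
    ultimately show ?thesis using nz[OF t] by (simp add: W'_def k_def)
  qed
  have "{t\<in>{0..T}. q t < (pi / T)\<^sup>2} \<subseteq> {0, T, t0}"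
  proof
    fix t assume t: "t \<in> {t\<in>{0..T}. q t < (pi / T)\<^sup>2}"
    show "t \<in> {0, T, t0}"
    proof (rule ccontr)
      assume "t \<notin> {0, T, t0}"
      then have "q t = (pi / T)\<^sup>2" using t by (intro qeq) auto
      then show False using t by simp
    qed
  qed
  then show False using strict finite_subset by blast
qed

section \<open>Monodromy\<close>

lemma has_vector_derivative_fst_snd:
  assumes "(z has_vector_derivative w) (at t within S)"
  shows "((\<lambda>t. fst (z t)) has_vector_derivative fst w) (at t within S)"
    and "((\<lambda>t. snd (z t)) has_vector_derivative snd w) (at t within S)"
  using bounded_linear.has_vector_derivative[OF bounded_linear_fst assms]
    bounded_linear.has_vector_derivative[OF bounded_linear_snd assms] by auto

text \<open>The normalization at 0 makes the values at \<open>T\<close> the monodromy matrix, with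
  rows \<open>(u T, v T)\<close> and \<open>(u' T, v' T)\<close>. Its trace
  \<open>u T + v' T\<close> is the coefficient in the characteristic equation used below.\<close>

definition fundamental_pair where
  "fundamental_pair T c a u u' v v' \<longleftrightarrow>
     damped_sol T c a u u' \<and> damped_sol T c a v v' \<and> u 0 = 1 \<and> u' 0 = 0 \<and> v 0 = 0 \<and> v' 0 = (1::real)"

lemma norm_le_sum_abs: "norm (z :: real \<times> real) \<le> \<bar>fst z\<bar> + \<bar>snd z\<bar>"
  using norm_Pair_le[of "fst z" "snd z"] by simp

lemma abs_components_le_norm: "\<bar>fst z\<bar> \<le> norm z" "\<bar>snd z\<bar> \<le> norm (z :: real \<times> real)"
  by (metis norm_fst_le norm_snd_le prod.collapse real_norm_def)+

text \<open>One Lipschitz constant for all first-order systems in play: \<open>f\<close> stands for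
  the linear term \<open>a t * p\<close> as well as for a difference of values of
  \<open>g\<close>.\<close>

lemma norm_damped_field_le:
  assumes "\<bar>f\<bar> \<le> A * \<bar>p\<bar>" "0 \<le> A" "0 \<le> c"
  shows "norm (q, - c * q - f) \<le> (1 + c + A) * norm (p :: real, q :: real)"
proof -
  have "norm (q, - c * q - f) \<le> \<bar>q\<bar> + \<bar>- c * q - f\<bar>"
    using norm_le_sum_abs[of "(q, - c * q - f)"] by simp
  also have "\<dots> \<le> \<bar>q\<bar> + (c * \<bar>q\<bar> + A * \<bar>p\<bar>)"
    using assms abs_triangle_ineq4[of "- c * q" f] by (simp add: abs_mult)
  also have "\<dots> \<le> norm (p, q) + (c * norm (p, q) + A * norm (p, q))"
    using assms abs_components_le_norm[of "(p, q)"] by (intro add_mono mult_left_mono) auto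
  finally show ?thesis by (simp add: algebra_simps)
qed

lemma fundamental_pair_exists:
  assumes cont: "continuous_on UNIV a" and bd: "\<And>t. \<bar>a t\<bar> \<le> A" and c: "0 \<le> c"
  obtains u u' v v' where "fundamental_pair T c a u u' v v'"
proof -
  define F where "F = (\<lambda>t z. (snd z, - c * snd z - a t * fst z :: real))"
  have A: "0 \<le> A" using bd[of 0] by linarith
  have sol: "\<exists>w w'. damped_sol T c a w w' \<and> w 0 = p \<and> w' 0 = q" for p q :: real
  proof -
    have "\<exists>z. z 0 = (p, q) \<and> continuous_on UNIV z \<and>
        (\<forall>t\<ge>0. (z has_vector_derivative F t (z t)) (at t within {0..}))"
    proof (rule global_lipschitz_ivp)
      show "continuous_on UNIV (\<lambda>(t, z). F t z)"
        unfolding F_def case_prod_beta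
        by (intro continuous_intros continuous_on_compose2[OF cont]) auto
      show "norm (F t y - F t z) \<le> (1 + c + A) * norm (y - z)" for t y z
      proof -
        have "F t y - F t z = (snd (y - z), - c * snd (y - z) - a t * fst (y - z))"
          by (simp add: F_def algebra_simps)
        moreover have "\<bar>a t * fst (y - z)\<bar> \<le> A * \<bar>fst (y - z)\<bar>"
          unfolding abs_mult by (intro mult_right_mono bd) auto
        ultimately show ?thesis
          using norm_damped_field_le[OF _ A c] by (metis prod.collapse)
      qed
      show "norm (F t 0) \<le> 0" for t by (simp add: F_def zero_prod_def[symmetric])
    qed (use c A in auto)
    then obtain z where z: "z 0 = (p, q)"
      "\<And>t. t \<ge> 0 \<Longrightarrow> (z has_vector_derivative F t (z t)) (at t within {0..})" by auto
    have "damped_sol T c a (\<lambda>t. fst (z t)) (\<lambda>t. snd (z t))"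
      unfolding damped_sol_def
    proof
      fix t assume t: "t \<in> {0..T}"
      have "(z has_vector_derivative F t (z t)) (at t within {0..T})"
        using z(2)[of t] t by (auto intro: has_vector_derivative_within_subset)
      from has_vector_derivative_fst_snd[OF this]
      show "((\<lambda>t. fst (z t)) has_real_derivative snd (z t)) (at t within {0..T}) \<and>
        ((\<lambda>t. snd (z t)) has_real_derivative - c * snd (z t) - a t * fst (z t)) (at t within {0..T})"
        by (simp add: F_def has_real_derivative_iff_has_vector_derivative)
    qed
    with z(1) show ?thesis by (metis fst_conv snd_conv)
  qed
  then show ?thesis
    using sol[of 1 0] sol[of 0 1] that unfolding fundamental_pair_def by blast
qed

text \<open>Cramer's rule: the three pairwise Wronskians are known from the initial values, and that
  of \<open>u\<close> and \<open>v\<close> never vanishes.\<close>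

lemma damped_sol_expand:
  assumes fp: "fundamental_pair T c a u u' v v'" and w: "damped_sol T c a w w'" and t: "t \<in> {0..T}"
  shows "w t = w 0 * u t + w' 0 * v t" "w' t = w 0 * u' t + w' 0 * v' t"
proof -
  let ?e = "exp (- c * t)"
  have u: "damped_sol T c a u u'" and v: "damped_sol T c a v v'"
    and ini: "u 0 = 1" "u' 0 = 0" "v 0 = 0" "v' 0 = 1"
    using fp by (auto simp: fundamental_pair_def)
  have W: "u t * v' t - v t * u' t = ?e" "w t * v' t - v t * w' t = ?e * w 0"
    "u t * w' t - w t * u' t = ?e * w' 0"
    using damped_sol_wronskian[OF u v t] damped_sol_wronskian[OF w v t] damped_sol_wronskian[OF u w t] ini
    by auto
  have "?e * w t = (u t * v' t - v t * u' t) * w t" by (simp only: W(1))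
  also have "\<dots> = u t * (w t * v' t - v t * w' t) + v t * (u t * w' t - w t * u' t)"
    by (simp add: algebra_simps)
  finally have "?e * w t = ?e * (w 0 * u t + w' 0 * v t)" unfolding W by (simp add: algebra_simps)
  then show "w t = w 0 * u t + w' 0 * v t" by simp
  have "?e * w' t = (u t * v' t - v t * u' t) * w' t" by (simp only: W(1))
  also have "\<dots> = u' t * (w t * v' t - v t * w' t) + v' t * (u t * w' t - w t * u' t)"
    by (simp add: algebra_simps)
  finally have "?e * w' t = ?e * (w 0 * u' t + w' 0 * v' t)" unfolding W by (simp add: algebra_simps)
  then show "w' t = w 0 * u' t + w' 0 * v' t" by simp
qed

lemma fundamental_pair_det:
  assumes "fundamental_pair T c a u u' v v'" "T > 0"
  shows "u T * v' T - v T * u' T = exp (- c * T)"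
  using damped_sol_wronskian[of T c a u u' v v' T] assms by (auto simp: fundamental_pair_def)

text \<open>Floquet's argument: the initial data \<open>(p, q)\<close> are an eigenvector of the
  monodromy matrix for the root \<open>r\<close> of its characteristic polynomial.\<close>

lemma floquet_solution:
  assumes fp: "fundamental_pair T c a u u' v v'" and T: "T > 0"
    and r: "r\<^sup>2 - (u T + v' T) * r + exp (- c * T) = 0"
  obtains w w' where "damped_sol T c a w w'" "w T = r * w 0" "w' T = r * w' 0"
    "\<And>t. t \<in> {0..T} \<Longrightarrow> w t \<noteq> 0 \<or> w' t \<noteq> 0"
proof -
  have u: "damped_sol T c a u u'" and v: "damped_sol T c a v v'"
    and ini: "u 0 = 1" "u' 0 = 0" "v 0 = 0" "v' 0 = 1"
    using fp by (auto simp: fundamental_pair_def)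
  have ch: "(r - u T) * (r - v' T) = v T * u' T"
    using r fundamental_pair_det[OF fp T] by (simp add: power2_eq_square algebra_simps)
  \<comment> \<open>Each row of \<open>M - r\<close> that is not zero yields a kernel vector, and
    the characteristic equation makes it satisfy the other row. If both rows vanish, every vector is
    an eigenvector.\<close>
  obtain p q where pq: "p \<noteq> 0 \<or> q \<noteq> 0" "p * u T + q * v T = r * p" "p * u' T + q * v' T = r * q"
  proof (cases "v T \<noteq> 0 \<or> r \<noteq> u T")
    case True
    then show ?thesis
      using that[of "v T" "r - u T"] ch by (auto simp: algebra_simps)
  next
    case f: False
    show ?thesis
    proof (cases "u' T \<noteq> 0 \<or> r \<noteq> v' T")
      case True
      then show ?thesis
        using that[of "r - v' T" "u' T"] ch f by (auto simp: algebra_simps)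
    next
      case False
      then show ?thesis using that[of 1 0] f by auto
    qed
  qed
  define w w' where "w = (\<lambda>t. p * u t + q * v t)" and "w' = (\<lambda>t. p * u' t + q * v' t)"
  have w: "damped_sol T c a w w'"
    unfolding w_def w'_def by (rule damped_sol_lincomb[OF u v])
  \<comment> \<open>A common zero of \<open>w\<close> and \<open>w'\<close> would annihilate the
    Wronskians with \<open>v\<close> and \<open>u\<close>, whose values at 0 are \<open>p\<close>
    and \<open>- q\<close>.\<close>
  have "w t \<noteq> 0 \<or> w' t \<noteq> 0" if t: "t \<in> {0..T}" for t
    using damped_sol_wronskian[OF w v t] damped_sol_wronskian[OF w u t] pq(1)
    by (auto simp: w_def w'_def ini)
  moreover have "w T = r * w 0" "w' T = r * w' 0"
    using pq by (auto simp: w_def w'_def ini)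
  ultimately show ?thesis using that w by blast
qed

lemma positive_multiplier_of_pair:
  assumes fp: "fundamental_pair T c a u u' v v'" and T: "T > 0" and c: "c > 0"
    and a: "\<And>t. t \<in> {0..T} \<Longrightarrow> a t \<le> (pi / T)\<^sup>2 + c\<^sup>2 / 4"
    and b: "continuous_on {0..T} \<beta>" "\<And>t. t \<in> {0..T} \<Longrightarrow> \<beta> t \<le> a t"
    and r: "r\<^sup>2 - (u T + v' T) * r + exp (- c * T) = 0" "r > 0"
  shows "r \<le> exp (- integral {0..T} \<beta> / c)"
proof -
  obtain w w' where w: "damped_sol T c a w w'" "w T = r * w 0" "w' T = r * w' 0"
    "\<And>t. t \<in> {0..T} \<Longrightarrow> w t \<noteq> 0 \<or> w' t \<noteq> 0"
    using floquet_solution[OF fp T r(1)] by blast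
  show ?thesis
    using positive_multiplier_bound[OF w(1) a w(4) T c w(2,3) r(2) b] by simp
qed

text \<open>Removing the damping turns the multiplier \<open>r\<close> into
  \<open>exp (c T / 2) r\<close>. The bound -1 for the latter is strict for \<open>r\<close>, as the
  factor exceeds 1.\<close>

lemma negative_multiplier_of_pair:
  assumes fp: "fundamental_pair T c a u u' v v'" and T: "T > 0" and c: "c > 0"
    and a: "\<And>t. t \<in> {0..T} \<Longrightarrow> a t \<le> (pi / T)\<^sup>2 + c\<^sup>2 / 4"
    and strict: "infinite {t\<in>{0..T}. a t < (pi / T)\<^sup>2 + c\<^sup>2 / 4}"
    and r: "r\<^sup>2 - (u T + v' T) * r + exp (- c * T) = 0" "r < 0"
  shows "- 1 < r"
proof -
  obtain w w' where w: "damped_sol T c a w w'" "w T = r * w 0" "w' T = r * w' 0"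
    "\<And>t. t \<in> {0..T} \<Longrightarrow> w t \<noteq> 0 \<or> w' t \<noteq> 0"
    using floquet_solution[OF fp T r(1)] by blast
  have "- 1 \<le> exp (c / 2 * T) * r"
  proof (rule negative_multiplier_bound[OF damped_sol_remove_damping[OF w(1)] _ _ T])
    show "exp (c / 2 * T) * w T = (exp (c / 2 * T) * r) * (exp (c / 2 * 0) * w 0)"
      "exp (c / 2 * T) * (w' T + c / 2 * w T) =
        (exp (c / 2 * T) * r) * (exp (c / 2 * 0) * (w' 0 + c / 2 * w 0))"
      using w by (auto simp: algebra_simps)
    have "{t \<in> {0..T}. a t - c\<^sup>2 / 4 < (pi / T)\<^sup>2} = {t\<in>{0..T}. a t < (pi / T)\<^sup>2 + c\<^sup>2 / 4}"
      by auto
    then show "infinite {t \<in> {0..T}. a t - c\<^sup>2 / 4 < (pi / T)\<^sup>2}" using strict by simp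
    show "exp (c / 2 * T) * r < 0" using r(2) by (simp add: mult_pos_neg)
  qed (use a w(4) in force)+
  moreover have "exp (c / 2 * T) * r < 1 * r"
    using T c r(2) by (intro mult_strict_right_mono_neg) auto
  ultimately show ?thesis by linarith
qed

section \<open>Determinant and spectrum of the monodromy matrix\<close>

lemma quadratic_real_root:
  fixes b d :: real
  assumes "0 \<le> b\<^sup>2 - 4 * d"
  shows "((b + sqrt (b\<^sup>2 - 4 * d)) / 2)\<^sup>2 - b * ((b + sqrt (b\<^sup>2 - 4 * d)) / 2) + d = 0"
    "((b - sqrt (b\<^sup>2 - 4 * d)) / 2)\<^sup>2 - b * ((b - sqrt (b\<^sup>2 - 4 * d)) / 2) + d = 0"
proof -
  have "(sqrt (b\<^sup>2 - 4 * d))\<^sup>2 = b\<^sup>2 - 4 * d" using assms by simp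
  then show "((b + sqrt (b\<^sup>2 - 4 * d)) / 2)\<^sup>2 - b * ((b + sqrt (b\<^sup>2 - 4 * d)) / 2) + d = 0"
    "((b - sqrt (b\<^sup>2 - 4 * d)) / 2)\<^sup>2 - b * ((b - sqrt (b\<^sup>2 - 4 * d)) / 2) + d = 0"
    by (simp_all add: power2_eq_square field_simps)
qed

text \<open>The determinant is \<open>(1 - r) (1 - s)\<close> for the multipliers \<open>r\<close>
  and \<open>s\<close>, or 1 - trace + \<open>exp (- c T)\<close>. For nonpositive trace it is at
  least 1. Otherwise the multipliers are either conjugate of modulus \<open>exp (- c T / 2)\<close>,
  or real, positive and bounded by \<open>positive_multiplier_of_pair\<close>.\<close>

lemma monodromy_minus_id_det:
  assumes fp: "fundamental_pair T c a u u' v v'" and T: "T > 0" and c: "c > 0"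
    and a: "\<And>t. t \<in> {0..T} \<Longrightarrow> a t \<le> (pi / T)\<^sup>2 + c\<^sup>2 / 4"
    and b: "continuous_on {0..T} \<beta>" "\<And>t. t \<in> {0..T} \<Longrightarrow> \<beta> t \<le> a t" "0 < integral {0..T} \<beta>"
  shows "min ((1 - exp (- integral {0..T} \<beta> / c))\<^sup>2) ((1 - exp (- c * T / 2))\<^sup>2)
      \<le> (u T - 1) * (v' T - 1) - v T * u' T"
proof -
  define \<tau> where "\<tau> = u T + v' T"
  define \<kappa> where "\<kappa> = exp (- integral {0..T} \<beta> / c)"
  define d where "d = exp (- c * T / 2)"
  have k: "0 < \<kappa>" "\<kappa> < 1" using b(3) c by (auto simp: \<kappa>_def)
  have d0: "0 < d" by (simp add: d_def)
  have d: "d\<^sup>2 = exp (- c * T)" by (simp add: d_def exp_double[symmetric])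
  have eq: "(u T - 1) * (v' T - 1) - v T * u' T = 1 - \<tau> + d\<^sup>2"
    using fundamental_pair_det[OF fp T] by (simp add: \<tau>_def d algebra_simps)
  consider "\<tau> \<le> 0" | "\<tau> > 0" "\<tau>\<^sup>2 < 4 * d\<^sup>2" | "\<tau> > 0" "4 * d\<^sup>2 \<le> \<tau>\<^sup>2" by linarith
  then have "(1 - \<kappa>)\<^sup>2 \<le> 1 - \<tau> + d\<^sup>2 \<or> (1 - d)\<^sup>2 \<le> 1 - \<tau> + d\<^sup>2"
  proof cases
    case 1
    have "(1 - \<kappa>)\<^sup>2 \<le> 1" using k by (simp add: power_le_one)
    then show ?thesis using 1 zero_le_power2[of d] by linarith
  next
    case 2
    then have "\<tau>\<^sup>2 < (2 * d)\<^sup>2" by (simp add: power_mult_distrib)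
    then have "\<tau> < 2 * d" by (rule power2_less_imp_less) (use d0 in simp)
    then show ?thesis by (simp add: power2_eq_square algebra_simps)
  next
    case 3
    define r where "r = (\<tau> + sqrt (\<tau>\<^sup>2 - 4 * d\<^sup>2)) / 2"
    define s where "s = (\<tau> - sqrt (\<tau>\<^sup>2 - 4 * d\<^sup>2)) / 2"
    have "r\<^sup>2 - \<tau> * r + d\<^sup>2 = 0" "0 < r"
      unfolding r_def using quadratic_real_root(1)[of \<tau> "d\<^sup>2"] 3 by (auto intro: add_pos_nonneg)
    then have "r \<le> \<kappa>"
      unfolding \<kappa>_def using positive_multiplier_of_pair[OF fp T c a b(1,2)] by (simp add: \<tau>_def d)
    moreover have "s \<le> r" using 3 by (simp add: r_def s_def)
    ultimately have "(1 - \<kappa>) * (1 - \<kappa>) \<le> (1 - r) * (1 - s)"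
      using k by (intro mult_mono) auto
    also have "(1 - r) * (1 - s) = 1 - \<tau> + r * s" by (simp add: r_def s_def field_simps)
    also have "r * s = d\<^sup>2"
      using 3 by (simp add: r_def s_def square_diff_square_factored[symmetric] power2_eq_square algebra_simps)
    finally show ?thesis by (simp add: power2_eq_square)
  qed
  then show ?thesis unfolding eq \<kappa>_def d_def by linarith
qed

lemma damped_sol_norm_bound:
  assumes w: "damped_sol T c a w w'" and bd: "\<And>t. t \<in> {0..T} \<Longrightarrow> \<bar>a t\<bar> \<le> A" and c: "0 \<le> c"
    and t: "t \<in> {0..T}"
  shows "norm (w t, w' t) \<le> exp ((2 + c + A) * t) * norm (w 0, w' 0)"
proof -
  have A: "0 \<le> A" using bd[OF t] by linarith
  have "norm ((\<lambda>t. (w t, w' t)) t) \<le> exp ((1 + c + A + 1) * t) * norm ((\<lambda>t. (w t, w' t)) 0)"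
  proof (rule norm_exp_bound[where z'="\<lambda>t. (w' t, - c * w' t - a t * w t)"])
    fix t assume t: "t \<in> {0..T}"
    show "((\<lambda>t. (w t, w' t)) has_vector_derivative (w' t, - c * w' t - a t * w t)) (at t within {0..T})"
      using w t unfolding damped_sol_def has_real_derivative_iff_has_vector_derivative
      by (intro has_vector_derivative_Pair) auto
    show "norm (w' t, - c * w' t - a t * w t) \<le> (1 + c + A) * norm (w t, w' t)"
      using bd[OF t] by (intro norm_damped_field_le A c) (simp add: abs_mult mult_right_mono)
  qed (use A c t in auto)
  then show ?thesis by (simp add: algebra_simps)
qed

text \<open>Cramer's rule for \<open>M - I\<close>: its determinant times the initial vector is the
  adjugate applied to the displacement. The entries are controlled by the growth of a unit initial
  vector, plus 1 for the identity.\<close>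

lemma displacement_lower_bound:
  assumes fp: "fundamental_pair T c a u u' v v'" and T: "T > 0" and c: "c > 0"
    and w: "damped_sol T c a w w'" and bd: "\<And>t. t \<in> {0..T} \<Longrightarrow> \<bar>a t\<bar> \<le> A"
    and \<delta>: "\<delta> \<le> (u T - 1) * (v' T - 1) - v T * u' T"
  shows "\<delta> * (\<bar>w 0\<bar> + \<bar>w' 0\<bar>) \<le>
    2 * (exp ((2 + c + A) * T) + 1) * (\<bar>w T - w 0\<bar> + \<bar>w' T - w' 0\<bar>)"
proof -
  define B where "B = exp ((2 + c + A) * T) + 1"
  define \<Delta> where "\<Delta> = (u T - 1) * (v' T - 1) - v T * u' T"
  define e1 where "e1 = w T - w 0"
  define e2 where "e2 = w' T - w' 0"
  have u: "damped_sol T c a u u'" and v: "damped_sol T c a v v'"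
    and ini: "u 0 = 1" "u' 0 = 0" "v 0 = 0" "v' 0 = 1"
    using fp by (auto simp: fundamental_pair_def)
  have TT: "T \<in> {0..T}" using T by simp
  have "norm (u T, u' T) \<le> B - 1" "norm (v T, v' T) \<le> B - 1"
    using damped_sol_norm_bound[OF u bd _ TT] damped_sol_norm_bound[OF v bd _ TT] c
    by (auto simp: ini B_def norm_Pair)
  then have B: "\<bar>u T - 1\<bar> \<le> B" "\<bar>u' T\<bar> \<le> B" "\<bar>v T\<bar> \<le> B" "\<bar>v' T - 1\<bar> \<le> B"
    using abs_components_le_norm[of "(u T, u' T)"] abs_components_le_norm[of "(v T, v' T)"] by auto
  have e: "e1 = (u T - 1) * w 0 + v T * w' 0" "e2 = u' T * w 0 + (v' T - 1) * w' 0"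
    using damped_sol_expand[OF fp w TT] by (auto simp: e1_def e2_def algebra_simps)
  have "\<Delta> * w 0 = (v' T - 1) * e1 - v T * e2" "\<Delta> * w' 0 = (u T - 1) * e2 - u' T * e1"
    by (simp_all add: e \<Delta>_def algebra_simps)
  moreover have "\<bar>x * y - z * w\<bar> \<le> B * (\<bar>y\<bar> + \<bar>w\<bar>)" if "\<bar>x\<bar> \<le> B" "\<bar>z\<bar> \<le> B" for x y z w
  proof -
    have "\<bar>x * y - z * w\<bar> \<le> \<bar>x\<bar> * \<bar>y\<bar> + \<bar>z\<bar> * \<bar>w\<bar>"
      using abs_triangle_ineq4[of "x * y" "z * w"] by (simp add: abs_mult)
    also have "\<dots> \<le> B * \<bar>y\<bar> + B * \<bar>w\<bar>" using that by (intro add_mono mult_right_mono) auto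
    finally show ?thesis by (simp add: algebra_simps)
  qed
  ultimately have "\<bar>\<Delta> * w 0\<bar> \<le> B * (\<bar>e1\<bar> + \<bar>e2\<bar>)" "\<bar>\<Delta> * w' 0\<bar> \<le> B * (\<bar>e2\<bar> + \<bar>e1\<bar>)"
    using B by auto
  then have "\<bar>\<Delta>\<bar> * (\<bar>w 0\<bar> + \<bar>w' 0\<bar>) \<le> 2 * B * (\<bar>e1\<bar> + \<bar>e2\<bar>)"
    by (simp add: abs_mult algebra_simps)
  moreover have "\<delta> * (\<bar>w 0\<bar> + \<bar>w' 0\<bar>) \<le> \<bar>\<Delta>\<bar> * (\<bar>w 0\<bar> + \<bar>w' 0\<bar>)"
    using \<delta> by (intro mult_right_mono) (auto simp: \<Delta>_def)
  ultimately show ?thesis unfolding B_def e1_def e2_def by linarith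
qed

text \<open>Real multipliers are covered by the two sign cases; a nonreal pair is conjugate, with
  squared modulus \<open>exp (- c T)\<close>. Sum and product over the complex numbers describe both
  kinds of spectrum at once, so that one norm construction suffices.\<close>

lemma multipliers_in_disc:
  assumes fp: "fundamental_pair T c a u u' v v'" and T: "T > 0" and c: "c > 0"
    and a: "\<And>t. t \<in> {0..T} \<Longrightarrow> a t \<le> (pi / T)\<^sup>2 + c\<^sup>2 / 4"
    and strict: "infinite {t\<in>{0..T}. a t < (pi / T)\<^sup>2 + c\<^sup>2 / 4}"
    and b: "continuous_on {0..T} \<beta>" "\<And>t. t \<in> {0..T} \<Longrightarrow> \<beta> t \<le> a t" "0 < integral {0..T} \<beta>"
  obtains r s :: complex where "r + s = of_real (u T + v' T)" "r * s = of_real (exp (- c * T))"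
    "cmod r < 1" "cmod s < 1"
proof -
  define \<tau> where "\<tau> = u T + v' T"
  define D where "D = exp (- c * T)"
  have D: "0 < D" "D < 1" using T c by (auto simp: D_def)
  have real_root: "\<bar>r\<bar> < 1" if r: "r\<^sup>2 - \<tau> * r + D = 0" for r
  proof -
    have "r \<noteq> 0" using r D by auto
    then consider "r > 0" | "r < 0" by linarith
    then show ?thesis
    proof cases
      case 1
      have "r \<le> exp (- integral {0..T} \<beta> / c)"
        using positive_multiplier_of_pair[OF fp T c a b(1,2) r[unfolded \<tau>_def D_def] 1] by simp
      also have "\<dots> < 1" using b(3) c by simp
      finally show ?thesis using 1 by simp
    next
      case 2
      then show ?thesis
        using negative_multiplier_of_pair[OF fp T c a strict r[unfolded \<tau>_def D_def] 2] by simp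
    qed
  qed
  show ?thesis
  proof (cases "0 \<le> \<tau>\<^sup>2 - 4 * D")
    case True
    define x y where "x = (\<tau> + sqrt (\<tau>\<^sup>2 - 4 * D)) / 2" and "y = (\<tau> - sqrt (\<tau>\<^sup>2 - 4 * D)) / 2"
    have "x + y = \<tau>" by (simp add: x_def y_def field_simps)
    moreover have "x * y = D"
      using True by (simp add: x_def y_def square_diff_square_factored[symmetric] power2_eq_square algebra_simps)
    moreover have "\<bar>x\<bar> < 1" "\<bar>y\<bar> < 1"
      unfolding x_def y_def using quadratic_real_root[OF True] by (intro real_root; simp)+
    ultimately show ?thesis
      unfolding \<tau>_def D_def
      by (intro that[of "of_real x" "of_real y"]) (simp_all only: norm_of_real flip: of_real_add of_real_mult)
  next
    case False
    define y where "y = sqrt (4 * D - \<tau>\<^sup>2) / 2"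
    have y: "y\<^sup>2 = D - \<tau>\<^sup>2 / 4" using False by (simp add: y_def power_divide)
    have "(cmod (Complex (\<tau> / 2) y))\<^sup>2 = D" "(cmod (Complex (\<tau> / 2) (- y)))\<^sup>2 = D"
      by (simp_all add: cmod_power2 y power_divide)
    then have "cmod (Complex (\<tau> / 2) y) < 1" "cmod (Complex (\<tau> / 2) (- y)) < 1"
      using D by (metis norm_ge_zero one_power2 power2_less_imp_less zero_le_one)+
    moreover have "Complex (\<tau> / 2) y + Complex (\<tau> / 2) (- y) = of_real \<tau>"
      by (simp add: complex_eq_iff)
    moreover have "Complex (\<tau> / 2) y * Complex (\<tau> / 2) (- y) = of_real D"
      using y by (simp add: complex_eq_iff power2_eq_square)
    ultimately show ?thesis using that by (simp add: \<tau>_def D_def)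
  qed
qed

text \<open>With \<open>(M - r) (M - s) = 0\<close>, the quantity \<open>\<bar>M z - r z\<bar>\<close> shrinks by the factor \<open>\<bar>s\<bar>\<close>,
  and \<open>\<bar>z\<bar>\<close> shrinks by \<open>\<bar>r\<bar>\<close> up to that quantity; the norm weights it accordingly.\<close>

lemma adapted_norm:
  fixes m11 m12 m21 m22 :: real and r s :: complex
  assumes rs: "r + s = of_real (m11 + m22)" "r * s = of_real (m11 * m22 - m12 * m21)"
    and r: "cmod r < 1" and s: "cmod s < 1"
  obtains N :: "real \<Rightarrow> real \<Rightarrow> real" and K \<rho> where "0 < \<rho>" "\<rho> < 1" "1 \<le> K"
    "\<And>p q. \<bar>p\<bar> + \<bar>q\<bar> \<le> N p q" "\<And>p q. N p q \<le> K * (\<bar>p\<bar> + \<bar>q\<bar>)"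
    "\<And>p q p' q'. N (p + p') (q + q') \<le> N p q + N p' q'"
    "\<And>p q. N (m11 * p + m12 * q) (m21 * p + m22 * q) \<le> \<rho> * N p q"
proof -
  \<comment> \<open>\<open>A\<close> and \<open>B\<close> are the components of
    \<open>(M - r) z\<close> for \<open>z = (p, q)\<close>, complex in general.\<close>
  define A where "A = (\<lambda>p q. of_real (m11 * p + m12 * q) - r * of_real p)"
  define B where "B = (\<lambda>p q. of_real (m21 * p + m22 * q) - r * of_real q)"
  define Q where "Q = (\<lambda>p q. cmod (A p q) + cmod (B p q))"
  \<comment> \<open>The weight solves \<open>1 + l |s| = l (1 + |s|) / 2\<close>: the contribution
    of \<open>Q\<close> to \<open>|M z|\<close> is absorbed at a rate halfway between
    \<open>|s|\<close> and 1.\<close>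
  define l where "l = 2 / (1 - cmod s)"
  define N where "N = (\<lambda>p q. (\<bar>p\<bar> + \<bar>q\<bar>) + l * Q p q)"
  define \<rho> where "\<rho> = max (cmod r) ((1 + cmod s) / 2)"
  define k where "k = \<bar>m11\<bar> + \<bar>m12\<bar> + \<bar>m21\<bar> + \<bar>m22\<bar> + 2 * cmod r"
  have l: "0 < l" using s by (simp add: l_def)
  have Q0: "0 \<le> Q p q" for p q by (simp add: Q_def)
  have rho: "0 < \<rho>" "\<rho> < 1" "cmod r \<le> \<rho>" "1 + l * cmod s \<le> l * \<rho>"
  proof -
    have "0 < (1 + cmod s) / 2" by (simp add: add_pos_nonneg)
    then show "0 < \<rho>" unfolding \<rho>_def by linarith
    have "1 + l * cmod s = l * ((1 + cmod s) / 2)" using s by (simp add: l_def field_simps)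
    also have "\<dots> \<le> l * \<rho>" using l by (intro mult_left_mono) (auto simp: \<rho>_def)
    finally show "1 + l * cmod s \<le> l * \<rho>" .
  qed (use r s in \<open>auto simp: \<rho>_def\<close>)
  have k: "0 \<le> k" by (simp add: k_def)
  have lower: "\<bar>p\<bar> + \<bar>q\<bar> \<le> N p q" for p q using l Q0[of p q] by (simp add: N_def)
  have QK: "Q p q \<le> k * (\<bar>p\<bar> + \<bar>q\<bar>)" for p q
  proof -
    have "cmod (A p q) \<le> \<bar>m11 * p + m12 * q\<bar> + cmod r * \<bar>p\<bar>"
      unfolding A_def by (rule order_trans[OF norm_triangle_ineq4]) (simp add: norm_mult del: of_real_add of_real_mult)
    also have "\<dots> \<le> \<bar>m11\<bar> * \<bar>p\<bar> + \<bar>m12\<bar> * \<bar>q\<bar> + cmod r * \<bar>p\<bar>"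
      using abs_triangle_ineq[of "m11 * p" "m12 * q"] by (simp add: abs_mult)
    finally have 1: "cmod (A p q) \<le> \<bar>m11\<bar> * \<bar>p\<bar> + \<bar>m12\<bar> * \<bar>q\<bar> + cmod r * \<bar>p\<bar>" .
    have "cmod (B p q) \<le> \<bar>m21 * p + m22 * q\<bar> + cmod r * \<bar>q\<bar>"
      unfolding B_def by (rule order_trans[OF norm_triangle_ineq4]) (simp add: norm_mult del: of_real_add of_real_mult)
    also have "\<dots> \<le> \<bar>m21\<bar> * \<bar>p\<bar> + \<bar>m22\<bar> * \<bar>q\<bar> + cmod r * \<bar>q\<bar>"
      using abs_triangle_ineq[of "m21 * p" "m22 * q"] by (simp add: abs_mult)
    finally have 2: "cmod (B p q) \<le> \<bar>m21\<bar> * \<bar>p\<bar> + \<bar>m22\<bar> * \<bar>q\<bar> + cmod r * \<bar>q\<bar>" .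
    have "0 \<le> \<bar>m11\<bar> * \<bar>q\<bar>" "0 \<le> \<bar>m12\<bar> * \<bar>p\<bar>" "0 \<le> \<bar>m21\<bar> * \<bar>q\<bar>" "0 \<le> \<bar>m22\<bar> * \<bar>p\<bar>"
      "0 \<le> cmod r * \<bar>p\<bar>" "0 \<le> cmod r * \<bar>q\<bar>" by auto
    moreover have "k * (\<bar>p\<bar> + \<bar>q\<bar>) = \<bar>m11\<bar> * \<bar>p\<bar> + \<bar>m12\<bar> * \<bar>p\<bar> + \<bar>m21\<bar> * \<bar>p\<bar> + \<bar>m22\<bar> * \<bar>p\<bar> + 2 * (cmod r * \<bar>p\<bar>)
        + (\<bar>m11\<bar> * \<bar>q\<bar> + \<bar>m12\<bar> * \<bar>q\<bar> + \<bar>m21\<bar> * \<bar>q\<bar> + \<bar>m22\<bar> * \<bar>q\<bar> + 2 * (cmod r * \<bar>q\<bar>))"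
      by (simp add: k_def algebra_simps)
    ultimately show ?thesis using 1 2 unfolding Q_def by linarith
  qed
  have upper: "N p q \<le> (1 + l * k) * (\<bar>p\<bar> + \<bar>q\<bar>)" for p q
    using mult_left_mono[OF QK[of p q], of l] l by (simp add: N_def algebra_simps)
  have tri: "N (p + p') (q + q') \<le> N p q + N p' q'" for p q p' q'
  proof -
    have "A (p + p') (q + q') = A p q + A p' q'" "B (p + p') (q + q') = B p q + B p' q'"
      by (simp_all add: A_def B_def algebra_simps)
    then have "Q (p + p') (q + q') \<le> Q p q + Q p' q'"
      unfolding Q_def
      using norm_triangle_ineq[of "A p q" "A p' q'"] norm_triangle_ineq[of "B p q" "B p' q'"] by simp
    then have "l * Q (p + p') (q + q') \<le> l * (Q p q + Q p' q')" using l by (intro mult_left_mono) auto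
    then show ?thesis
      unfolding N_def using abs_triangle_ineq[of p p'] abs_triangle_ineq[of q q']
      by (simp add: distrib_left)
  qed
  have contr: "N (m11 * p + m12 * q) (m21 * p + m22 * q) \<le> \<rho> * N p q" for p q
  proof -
    let ?p = "m11 * p + m12 * q" and ?q = "m21 * p + m22 * q"
    have sr: "s = of_real (m11 + m22) - r" using rs(1) by (simp add: algebra_simps)
    have rr: "r * (of_real (m11 + m22) - r) = of_real (m11 * m22 - m12 * m21)"
      using rs(2) by (simp add: sr)
    \<comment> \<open>This is a component of \<open>(M - s) (M - r) z\<close>, which by
      Cayley-Hamilton is \<open>r s - det M\<close> times \<open>z\<close>.\<close>
    have "A ?p ?q - s * A p q =
      of_real p * (r * (of_real (m11 + m22) - r) - of_real (m11 * m22 - m12 * m21))"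
      unfolding A_def sr by (simp add: algebra_simps)
    then have As: "A ?p ?q = s * A p q" unfolding rr by simp
    have "B ?p ?q - s * B p q =
      of_real q * (r * (of_real (m11 + m22) - r) - of_real (m11 * m22 - m12 * m21))"
      unfolding B_def sr by (simp add: algebra_simps)
    then have Bs: "B ?p ?q = s * B p q" unfolding rr by simp
    have Qs: "Q ?p ?q = cmod s * Q p q" by (simp add: Q_def As Bs norm_mult distrib_left)
    have "cmod (of_real ?p) \<le> cmod (A p q) + cmod (r * of_real p)"
      unfolding A_def using norm_triangle_ineq[of "of_real ?p - r * of_real p" "r * of_real p"] by simp
    then have 1: "\<bar>?p\<bar> \<le> cmod (A p q) + cmod r * \<bar>p\<bar>" by (simp only: norm_of_real norm_mult)
    have "cmod (of_real ?q) \<le> cmod (B p q) + cmod (r * of_real q)"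
      unfolding B_def using norm_triangle_ineq[of "of_real ?q - r * of_real q" "r * of_real q"] by simp
    then have 2: "\<bar>?q\<bar> \<le> cmod (B p q) + cmod r * \<bar>q\<bar>" by (simp only: norm_of_real norm_mult)
    have "\<bar>?p\<bar> + \<bar>?q\<bar> \<le> cmod r * (\<bar>p\<bar> + \<bar>q\<bar>) + Q p q"
      using 1 2 by (simp add: Q_def algebra_simps)
    moreover have "N ?p ?q = (\<bar>?p\<bar> + \<bar>?q\<bar>) + l * cmod s * Q p q" by (simp add: N_def Qs)
    ultimately have "N ?p ?q \<le> cmod r * (\<bar>p\<bar> + \<bar>q\<bar>) + (1 + l * cmod s) * Q p q"
      by (simp add: distrib_right)
    also have "\<dots> \<le> \<rho> * (\<bar>p\<bar> + \<bar>q\<bar>) + (l * \<rho>) * Q p q"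
      using rho Q0 by (intro add_mono mult_right_mono) auto
    finally show ?thesis by (simp add: N_def algebra_simps)
  qed
  show ?thesis
    by (rule that[where N=N and K="1 + l * k" and \<rho>=\<rho>]) (use rho(1,2) lower upper tri contr l k in auto)
qed

section \<open>Surjectivity of expansive maps, and bounds for periodic functions\<close>

lemma expansive_imp_surj:
  fixes f :: "'a::euclidean_space \<Rightarrow> 'a"
  assumes cont: "continuous_on UNIV f" and "\<delta> > 0"
    and lower: "\<And>x y. \<delta> * norm (x - y) \<le> norm (f x - f y)"
  shows "surj f"
proof -
  have inj: "inj f"
  proof (rule injI)
    fix x y assume "f x = f y"
    then show "x = y" using lower[of x y] \<open>\<delta> > 0\<close> by (simp add: mult_le_0_iff)
  qed
  have "open (f ` UNIV)"
    by (rule invariance_of_domain[OF cont open_UNIV inj])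
  \<comment> \<open>Expansiveness turns a convergent sequence of values into a Cauchy sequence of
    preimages.\<close>
  moreover have "closed (f ` UNIV)"
    unfolding closed_sequential_limits
  proof (intro allI impI, elim conjE)
    fix s l assume s: "\<forall>n. s n \<in> range f" "s \<longlonglongrightarrow> l"
    then have "\<forall>n. \<exists>x. s n = f x" by auto
    from choice[OF this] obtain x where x: "\<And>n. s n = f (x n)" by blast
    have "Cauchy s" using s(2) by (rule LIMSEQ_imp_Cauchy)
    have "Cauchy x"
    proof (rule metric_CauchyI)
      fix e :: real assume "e > 0"
      then obtain M where M: "\<And>m n. m \<ge> M \<Longrightarrow> n \<ge> M \<Longrightarrow> dist (s m) (s n) < \<delta> * e"
        using metric_CauchyD[OF \<open>Cauchy s\<close>, of "\<delta> * e"] \<open>\<delta> > 0\<close> by auto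
      have "dist (x m) (x n) < e" if "m \<ge> M" "n \<ge> M" for m n
      proof -
        have "\<delta> * dist (x m) (x n) < \<delta> * e"
          using lower[of "x m" "x n"] M[OF that] by (simp add: x dist_norm)
        then show ?thesis using \<open>\<delta> > 0\<close> by simp
      qed
      then show "\<exists>M. \<forall>m\<ge>M. \<forall>n\<ge>M. dist (x m) (x n) < e" by blast
    qed
    then obtain y where "x \<longlonglongrightarrow> y" by (auto simp: Cauchy_convergent_iff convergent_def)
    then have "(\<lambda>n. f (x n)) \<longlonglongrightarrow> f y"
      using cont by (auto simp: continuous_on_eq_continuous_at isCont_def intro: isCont_tendsto_compose)
    then have "l = f y" using s(2) x LIMSEQ_unique by (metis (no_types, lifting) ext)
    then show "l \<in> range f" by simp
  qed
  ultimately show "surj f"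
    using connected_clopen[of "UNIV :: 'a set"] connected_UNIV by auto
qed

lemma periodic_continuous_bounded:
  fixes f :: "real \<Rightarrow> real"
  assumes cont: "continuous_on UNIV f" and per: "periodic_fun_simple f T" and T: "T > 0"
  obtains B where "\<And>t. \<bar>f t\<bar> \<le> B"
proof -
  interpret periodic_fun_simple f T by (rule per)
  have "compact (f ` {0..T})"
    by (intro compact_continuous_image continuous_on_subset[OF cont]) auto
  then obtain B where B: "\<And>t. t \<in> {0..T} \<Longrightarrow> \<bar>f t\<bar> \<le> B"
    using compact_imp_bounded bounded_iff by (metis image_eqI real_norm_def)
  have "\<bar>f t\<bar> \<le> B" for t
  proof -
    define n where "n = \<lfloor>t / T\<rfloor>"
    have "of_int n \<le> t / T" "t / T < of_int n + 1" unfolding n_def by linarith+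
    then have "t - of_int n * T \<in> {0..T}" using T by (auto simp: field_simps)
    then have "\<bar>f (t - of_int n * T)\<bar> \<le> B" by (rule B)
    then show ?thesis by (simp add: minus_of_int)
  qed
  then show ?thesis using that by blast
qed

lemma periodic_plus_of_nat:
  assumes "periodic_fun_simple f T"
  shows "f (t + of_nat n * T) = f t"
proof -
  interpret periodic_fun_simple f T by (rule assms)
  show ?thesis by (rule plus_of_nat)
qed

section \<open>The nonlinear equation\<close>

text \<open>The hypotheses in the form the argument consumes: pointwise bounds on one period and a
  global bound \<open>A\<close>, which yields global solutions. In \<open>strict\<close>, an
  infinite set stands for one of positive measure, because the Sturm argument leaves at most three
  exceptional points.\<close>

locale duffing =
  fixes T c A :: real and h \<beta> :: "real \<Rightarrow> real" and g g' :: "real \<Rightarrow> real \<Rightarrow> real"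
  assumes T: "T > 0" and c: "c > 0"
    and cont_h: "continuous_on UNIV h" and per_h: "periodic_fun_simple h T"
    and cont_g: "continuous_on UNIV (\<lambda>(t, x). g t x)"
    and per_g: "\<And>x. periodic_fun_simple (\<lambda>t. g t x) T"
    and der_g: "\<And>t x. (g t has_real_derivative g' t x) (at x)"
    and cont_g': "continuous_on UNIV (\<lambda>(t, x). g' t x)"
    and bound: "\<And>t x. \<bar>g' t x\<bar> \<le> A"
    and upper: "\<And>t x. t \<in> {0..T} \<Longrightarrow> g' t x \<le> (pi / T)\<^sup>2 + c\<^sup>2 / 4"
    and strict: "infinite {t\<in>{0..T}. \<forall>x. g' t x < (pi / T)\<^sup>2 + c\<^sup>2 / 4}"
    and cont_\<beta>: "continuous_on UNIV \<beta>" and int_\<beta>: "integral {0..T} \<beta> > 0"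
    and lower: "\<And>t x. t \<in> {0..T} \<Longrightarrow> \<beta> t \<le> g' t x"
begin

abbreviation sol :: "(real \<Rightarrow> real) \<Rightarrow> (real \<Rightarrow> real) \<Rightarrow> bool" where
  "sol \<equiv> duffing_solution_on {0..} c g h"

section \<open>Forward solutions and their differences\<close>

lemma A_nonneg: "0 \<le> A"
  using bound[of 0 0] by linarith

lemma lipschitz: "\<bar>g t x - g t y\<bar> \<le> A * \<bar>x - y\<bar>"
proof -
  have "norm (g t x - g t y) \<le> A * norm (x - y)"
    by (rule field_differentiable_bound[of UNIV "g t" "g' t"]) (use der_g[of t] bound in auto)
  then show ?thesis by simp
qed

lemma continuous_on_g [continuous_intros]:
  assumes "continuous_on S p" "continuous_on S q"
  shows "continuous_on S (\<lambda>s. g (p s) (q s))" "continuous_on S (\<lambda>s. g' (p s) (q s))"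
  using continuous_on_compose2[OF cont_g continuous_on_Pair[OF assms]]
    continuous_on_compose2[OF cont_g' continuous_on_Pair[OF assms]] by auto

lemma solD:
  assumes "sol x x'" "0 \<le> t"
  shows "(x has_real_derivative x' t) (at t within {0..})"
    and "(x' has_real_derivative h t - c * x' t - g t (x t)) (at t within {0..})"
proof -
  obtain x'' where *: "(x has_real_derivative x' t) (at t within {0..})"
    "(x' has_real_derivative x'' t) (at t within {0..})" "x'' t + c * x' t + g t (x t) = h t"
    using assms unfolding duffing_solution_on_def by auto
  then have "x'' t = h t - c * x' t - g t (x t)" by linarith
  with * show "(x has_real_derivative x' t) (at t within {0..})"
    "(x' has_real_derivative h t - c * x' t - g t (x t)) (at t within {0..})" by auto
qed

lemma solI:
  assumes "\<And>t. 0 \<le> t \<Longrightarrow> (x has_real_derivative x' t) (at t within {0..})"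
    and "\<And>t. 0 \<le> t \<Longrightarrow> (x' has_real_derivative h t - c * x' t - g t (x t)) (at t within {0..})"
  shows "sol x x'"
  unfolding duffing_solution_on_def
  by (rule exI[of _ "\<lambda>t. h t - c * x' t - g t (x t)"]) (use assms in auto)

lemma sol_cont: "sol x x' \<Longrightarrow> continuous_on {0..} x"
  using solD(1) DERIV_continuous by (force simp: continuous_on_eq_continuous_within)

lemma sol_exists: "\<exists>x x'. sol x x' \<and> x 0 = p \<and> x' 0 = q"
proof -
  define F where "F = (\<lambda>t z. (snd z, - c * snd z - (g t (fst z) - h t)))"
  have per: "periodic_fun_simple (\<lambda>t. g t 0 - h t) T"
    using per_g[of 0] per_h by (simp add: periodic_fun_simple_def)
  have cont: "continuous_on UNIV (\<lambda>t. g t 0 - h t)"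
    by (intro continuous_intros cont_h)
  obtain B where B: "\<And>t. \<bar>g t 0 - h t\<bar> \<le> B"
    by (rule periodic_continuous_bounded[OF cont per T]) blast
  have "\<exists>z. z 0 = (p, q) \<and> continuous_on UNIV z \<and>
      (\<forall>t\<ge>0. (z has_vector_derivative F t (z t)) (at t within {0..}))"
  proof (rule global_lipschitz_ivp)
    show "continuous_on UNIV (\<lambda>(t, z). F t z)"
      unfolding F_def case_prod_beta
      by (intro continuous_intros continuous_on_compose2[OF cont_h]) auto
    show "norm (F t y - F t z) \<le> (1 + c + A) * norm (y - z)" for t y z
    proof -
      have "F t y - F t z = (snd (y - z), - c * snd (y - z) - (g t (fst y) - g t (fst z)))"
        by (simp add: F_def algebra_simps)
      moreover have "\<bar>g t (fst y) - g t (fst z)\<bar> \<le> A * \<bar>fst (y - z)\<bar>"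
        using lipschitz by simp
      ultimately show ?thesis
        using norm_damped_field_le[OF _ A_nonneg less_imp_le[OF c], of _ "fst (y - z)" "snd (y - z)"]
        by (simp add: minus_prod_def)
    qed
    show "norm (F t 0) \<le> B" for t using B[of t] by (simp add: F_def norm_Pair abs_minus_commute)
  qed (use c A_nonneg in auto)
  then obtain z where z: "z 0 = (p, q)"
    "\<And>t. t \<ge> 0 \<Longrightarrow> (z has_vector_derivative F t (z t)) (at t within {0..})" by auto
  have "sol (\<lambda>t. fst (z t)) (\<lambda>t. snd (z t))"
  proof (rule solI)
    fix t :: real assume t: "0 \<le> t"
    note d = has_vector_derivative_fst_snd[OF z(2)[OF t]]
    show "((\<lambda>t. fst (z t)) has_real_derivative snd (z t)) (at t within {0..})"
      "((\<lambda>t. snd (z t)) has_real_derivative h t - c * snd (z t) - g t (fst (z t))) (at t within {0..})"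
      using d by (simp_all add: F_def has_real_derivative_iff_has_vector_derivative algebra_simps)
  qed
  with z(1) show ?thesis by (metis fst_conv snd_conv)
qed

text \<open>The difference quotient of \<open>g t\<close> in integral form: it remains continuous
  where \<open>x\<close> and \<open>y\<close> coincide and inherits every pointwise bound on
  \<open>g'\<close>.\<close>

definition slope :: "real \<Rightarrow> real \<Rightarrow> real \<Rightarrow> real" where
  "slope t x y = integral {0..1} (\<lambda>s. g' t (y + s * (x - y)))"

lemma slope_integrable: "(\<lambda>s. g' t (y + s * (x - y))) integrable_on {0..1}"
  by (intro integrable_continuous_real continuous_intros)

lemma slope_mult: "slope t x y * (x - y) = g t x - g t y"
proof -
  have "((\<lambda>s. g' t (y + s * (x - y)) * (x - y)) has_integral
      g t (y + 1 * (x - y)) - g t (y + 0 * (x - y))) {0..1}"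
    by (rule fundamental_theorem_of_calculus)
      (auto intro!: derivative_eq_intros DERIV_chain2[OF der_g]
        simp: has_real_derivative_iff_has_vector_derivative[symmetric])
  then show ?thesis
    using has_integral_mult_left[OF integrable_integral[OF slope_integrable[of t y x]], of "x - y"]
    by (simp add: slope_def has_integral_unique)
qed

lemma slope_le:
  assumes "\<And>z. g' t z \<le> M" shows "slope t x y \<le> M"
proof -
  have "slope t x y \<le> integral {0..1} (\<lambda>s::real. M)"
    unfolding slope_def by (intro integral_le slope_integrable) (use assms in auto)
  then show ?thesis by simp
qed

lemma slope_ge:
  assumes "\<And>z. M \<le> g' t z" shows "M \<le> slope t x y"
proof -
  have "integral {0..1} (\<lambda>s::real. M) \<le> slope t x y"
    unfolding slope_def by (intro integral_le slope_integrable) (use assms in auto)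
  then show ?thesis by simp
qed

lemma slope_abs_le: "\<bar>slope t x y\<bar> \<le> A"
  using slope_le[of t A x y] slope_ge[of "- A" t x y] bound[of t] by (simp add: abs_le_iff minus_le_iff)

lemma slope_cont:
  assumes "continuous_on UNIV p" "continuous_on UNIV x" "continuous_on UNIV y"
  shows "continuous_on UNIV (\<lambda>t::real. slope (p t) (x t) (y t))"
proof -
  have 1: "continuous_on (UNIV \<times> cbox 0 1) (\<lambda>(t, s). g' (p t) (y t + s * (x t - y t)))"
    unfolding case_prod_beta
    by (intro continuous_intros continuous_on_compose2[OF assms(1)]
        continuous_on_compose2[OF assms(2)] continuous_on_compose2[OF assms(3)]) auto
  show ?thesis
    using integral_continuous_on_param[OF 1] by (simp add: slope_def)
qed

text \<open>Through \<open>slope\<close>, the difference of two solutions solves a linear equation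
  exactly, not merely to first order. The coefficient depends on the pair, its bounds do
  not.\<close>

lemma sol_diff:
  assumes x: "sol x x'" and y: "sol y y'"
  obtains a where "continuous_on UNIV a" "\<And>t. \<bar>a t\<bar> \<le> A"
    "\<And>t. t \<in> {0..T} \<Longrightarrow> a t \<le> (pi / T)\<^sup>2 + c\<^sup>2 / 4" "\<And>t. t \<in> {0..T} \<Longrightarrow> \<beta> t \<le> a t"
    "\<And>b. damped_sol b c a (\<lambda>t. x t - y t) (\<lambda>t. x' t - y' t)"
proof
  \<comment> \<open>Freezing the coefficient at its value at 0 for negative times makes it
    continuous and bounded on the whole line, as \<open>fundamental_pair_exists\<close>
    demands.\<close>
  define a where "a = (\<lambda>t. slope (max 0 t) (x (max 0 t)) (y (max 0 t)))"
  show "continuous_on UNIV a"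
    unfolding a_def
    by (intro slope_cont continuous_on_compose2[OF sol_cont[OF x]]
        continuous_on_compose2[OF sol_cont[OF y]] continuous_intros) auto
  show "\<bar>a t\<bar> \<le> A" for t by (simp add: a_def slope_abs_le)
  show "a t \<le> (pi / T)\<^sup>2 + c\<^sup>2 / 4" if "t \<in> {0..T}" for t
    using that by (auto simp: a_def intro!: slope_le upper)
  show "\<beta> t \<le> a t" if "t \<in> {0..T}" for t
    using that by (auto simp: a_def intro!: slope_ge lower)
  show "damped_sol b c a (\<lambda>t. x t - y t) (\<lambda>t. x' t - y' t)" for b
    unfolding damped_sol_def
  proof (intro ballI conjI)
    fix t assume t: "t \<in> {0..b}"
    have sub: "{0..b} \<subseteq> {0..}" by auto
    have t0: "0 \<le> t" using t by simp
    note dx = solD[OF x t0, THEN DERIV_subset, OF sub] and dy = solD[OF y t0, THEN DERIV_subset, OF sub]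
    show "((\<lambda>t. x t - y t) has_real_derivative x' t - y' t) (at t within {0..b})"
      by (intro DERIV_diff dx dy)
    have "a t * (x t - y t) = g t (x t) - g t (y t)"
      using t0 by (simp add: a_def slope_mult max_def)
    then show "((\<lambda>t. x' t - y' t) has_real_derivative
        - c * (x' t - y' t) - a t * (x t - y t)) (at t within {0..b})"
      by (intro DERIV_cong[OF DERIV_diff[OF dx(2) dy(2)]]) (simp add: algebra_simps)
  qed
qed

section \<open>The Poincare map and the periodic solution\<close>

lemma sol_diff_growth:
  assumes "sol x x'" "sol y y'" "0 \<le> t"
  shows "norm (x t - y t, x' t - y' t) \<le> exp ((2 + c + A) * t) * norm (x 0 - y 0, x' 0 - y' 0)"
proof -
  obtain a where a: "\<And>t. \<bar>a t\<bar> \<le> A" "\<And>b. damped_sol b c a (\<lambda>t. x t - y t) (\<lambda>t. x' t - y' t)"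
    by (rule sol_diff[OF assms(1,2)]) blast
  show ?thesis
    using damped_sol_norm_bound[OF a(2)[of t] a(1)] c assms(3) by simp
qed

lemma sol_unique:
  assumes "sol x x'" "sol y y'" "x 0 = y 0" "x' 0 = y' 0" "0 \<le> t"
  shows "x t = y t" "x' t = y' t"
proof -
  have "norm (x t - y t, x' t - y' t) \<le> 0"
    using sol_diff_growth[OF assms(1,2,5)] assms(3,4) by (simp add: zero_prod_def[symmetric])
  then show "x t = y t" "x' t = y' t" unfolding norm_le_zero_iff by (auto simp: zero_prod_def)
qed

text \<open>\<mu> bounds the determinant of \<open>M - I\<close> from below and \<open>B\<close>
  comes from the entries of \<open>M\<close>. Neither involves the two solutions, which is what
  makes \<delta> uniform.\<close>

lemma displacement_expansive:
  obtains \<delta> where "\<delta> > 0"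
    "\<And>x x' y y'. sol x x' \<Longrightarrow> sol y y' \<Longrightarrow>
      \<delta> * (\<bar>x 0 - y 0\<bar> + \<bar>x' 0 - y' 0\<bar>) \<le>
      \<bar>(x T - y T) - (x 0 - y 0)\<bar> + \<bar>(x' T - y' T) - (x' 0 - y' 0)\<bar>"
proof
  define \<mu> where "\<mu> = min ((1 - exp (- integral {0..T} \<beta> / c))\<^sup>2) ((1 - exp (- c * T / 2))\<^sup>2)"
  define B where "B = 2 * (exp ((2 + c + A) * T) + 1)"
  have B: "B > 0" by (simp add: B_def add_pos_pos)
  have "\<mu> > 0" using int_\<beta> c T by (simp add: \<mu>_def)
  then show "\<mu> / B > 0" using B by simp
  fix x x' y y' assume "sol x x'" "sol y y'"
  then obtain a where a: "continuous_on UNIV a" "\<And>t. \<bar>a t\<bar> \<le> A"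
    "\<And>t. t \<in> {0..T} \<Longrightarrow> a t \<le> (pi / T)\<^sup>2 + c\<^sup>2 / 4" "\<And>t. t \<in> {0..T} \<Longrightarrow> \<beta> t \<le> a t"
    "damped_sol T c a (\<lambda>t. x t - y t) (\<lambda>t. x' t - y' t)"
    by (rule sol_diff) blast
  obtain u u' v v' where fp: "fundamental_pair T c a u u' v v'"
    using fundamental_pair_exists[OF a(1,2)] c by (metis less_imp_le)
  have "\<mu> \<le> (u T - 1) * (v' T - 1) - v T * u' T"
    unfolding \<mu>_def
    by (rule monodromy_minus_id_det[OF fp T c a(3) _ a(4) int_\<beta>])
      (auto intro: continuous_on_subset[OF cont_\<beta>])
  from displacement_lower_bound[OF fp T c a(5) a(2) this]
  show "\<mu> / B * (\<bar>x 0 - y 0\<bar> + \<bar>x' 0 - y' 0\<bar>) \<le>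
      \<bar>(x T - y T) - (x 0 - y 0)\<bar> + \<bar>(x' T - y' T) - (x' 0 - y' 0)\<bar>"
    unfolding B_def[symmetric]
    by (simp only: times_divide_eq_left pos_divide_le_eq[OF B] mult.commute[of _ B])
qed

lemma boundary_value_sol:
  obtains x x' where "sol x x'" "x T = x 0" "x' T = x' 0"
proof -
  obtain X X' where X: "\<And>z. sol (X z) (X' z)" "\<And>z. X z 0 = fst z" "\<And>z. X' z 0 = snd z"
  proof -
    have "\<forall>z. \<exists>w. sol (fst w) (snd w) \<and> fst w 0 = fst z \<and> snd w 0 = snd z"
      using sol_exists by (metis fst_conv snd_conv)
    then obtain W where "\<And>z. sol (fst (W z)) (snd (W z)) \<and> fst (W z) 0 = fst z \<and> snd (W z) 0 = snd z"
      by metis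
    then show ?thesis using that[of "\<lambda>z. fst (W z)" "\<lambda>z. snd (W z)"] by blast
  qed
  define G where "G = (\<lambda>z. (X z T, X' z T) - z)"
  obtain \<delta> where \<delta>: "\<delta> > 0" and exp:
    "\<And>x x' y y'. sol x x' \<Longrightarrow> sol y y' \<Longrightarrow>
      \<delta> * (\<bar>x 0 - y 0\<bar> + \<bar>x' 0 - y' 0\<bar>) \<le>
      \<bar>(x T - y T) - (x 0 - y 0)\<bar> + \<bar>(x' T - y' T) - (x' 0 - y' 0)\<bar>"
    by (rule displacement_expansive) blast
  have diff: "(X z T, X' z T) - (X w T, X' w T) = (X z T - X w T, X' z T - X' w T)" for z w
    by simp
  have "surj G"
  proof (rule expansive_imp_surj)
    show "continuous_on UNIV G"
    proof -
      have "(exp ((2 + c + A) * T))-lipschitz_on UNIV (\<lambda>z. (X z T, X' z T))"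
      proof (rule lipschitz_onI)
        fix z w :: "real \<times> real"
        show "dist (X z T, X' z T) (X w T, X' w T) \<le> exp ((2 + c + A) * T) * dist z w"
          using sol_diff_growth[OF X(1) X(1), of T z w] T
          by (simp add: dist_norm X(2,3) minus_prod_def)
      qed simp
      then show ?thesis
        unfolding G_def by (intro continuous_intros lipschitz_on_continuous_on)
    qed
    \<comment> \<open>The factor 1/2 pays for passing from the sum of absolute values to the
      Euclidean norm.\<close>
    show "\<delta> / 2 * norm (z - w) \<le> norm (G z - G w)" for z w
    proof -
      have "\<delta> * norm (z - w) \<le> \<delta> * (\<bar>fst (z - w)\<bar> + \<bar>snd (z - w)\<bar>)"
        using \<delta> by (intro mult_left_mono norm_le_sum_abs) auto
      also have "\<dots> \<le> \<bar>fst (G z - G w)\<bar> + \<bar>snd (G z - G w)\<bar>"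
        using exp[OF X(1) X(1), of z w] by (simp add: X(2,3) G_def algebra_simps)
      also have "\<dots> \<le> 2 * norm (G z - G w)"
        using abs_components_le_norm[of "G z - G w"] by linarith
      finally show ?thesis by simp
    qed
  qed (use \<delta> in simp)
  then obtain z where "G z = 0" by (metis surjD)
  then show ?thesis
    using that[OF X(1)[of z]] by (auto simp: G_def X(2,3) prod_eq_iff)
qed

lemma sol_shift:
  assumes x: "sol x x'"
  shows "sol (\<lambda>t. x (t + of_nat n * T)) (\<lambda>t. x' (t + of_nat n * T))"
proof -
  have shift: "((\<lambda>t. f (t + of_nat n * T)) has_real_derivative d) (at t within {0..})"
    if "(f has_real_derivative d) (at (t + of_nat n * T) within {0..})" for f d t
  proof -
    have "(f has_real_derivative d) (at (t + of_nat n * T) within (\<lambda>t. t + of_nat n * T) ` {0..})"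
      by (rule DERIV_subset[OF that]) (use T in auto)
    moreover have "((\<lambda>t. t + of_nat n * T) has_real_derivative 1) (at t within {0..})"
      by (auto intro!: derivative_eq_intros)
    ultimately show ?thesis 
      using DERIV_image_chain[of f d "\<lambda>t. t + of_nat n * T" t "{0..}" 1] by (simp add: o_def)
  qed
  show ?thesis
  proof (rule solI)
    fix t :: real assume t: "0 \<le> t"
    have t': "0 \<le> t + of_nat n * T" using t T by simp
    have "h (t + of_nat n * T) = h t" "g (t + of_nat n * T) y = g t y" for y
      using periodic_plus_of_nat[OF per_h] periodic_plus_of_nat[OF per_g] by auto
    then show "((\<lambda>t. x (t + of_nat n * T)) has_real_derivative x' (t + of_nat n * T)) (at t within {0..})"
      "((\<lambda>t. x' (t + of_nat n * T)) has_real_derivative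
        h t - c * x' (t + of_nat n * T) - g t (x (t + of_nat n * T))) (at t within {0..})"
      using shift[OF solD(1)[OF x t']] shift[OF solD(2)[OF x t']] by auto
  qed
qed

text \<open>The boundary value solution is known only for \<open>t \<ge> 0\<close>, where uniqueness
  makes it periodic. It is continued to negative times by shifting \<open>t\<close> forward by
  enough periods; how many does not matter.\<close>

lemma periodic_solution_exists: "\<exists>x. periodic_solution T c g h x"
proof -
  obtain x x' where x: "sol x x'" and bv: "x T = x 0" "x' T = x' 0"
    by (rule boundary_value_sol) blast
  have step: "x (t + T) = x t" "x' (t + T) = x' t" if "0 \<le> t" for t
    using sol_unique[OF sol_shift[OF x, of 1] x _ _ that] bv by simp_all
  have per: "x (t + of_nat n * T) = x t \<and> x' (t + of_nat n * T) = x' t" if "0 \<le> t" for t n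
  proof (induction n)
    case (Suc n)
    then show ?case using step[of "t + of_nat n * T"] that T by (simp add: algebra_simps)
  qed simp
  define k where "k = (\<lambda>t. nat \<lceil>\<bar>t\<bar> / T\<rceil>)"
  have k: "0 \<le> t + of_nat (k t) * T" for t
  proof -
    have "\<bar>t\<bar> / T \<le> of_nat (k t)" unfolding k_def by linarith
    then have "\<bar>t\<bar> \<le> of_nat (k t) * T" using T by (simp add: field_simps)
    then show ?thesis by linarith
  qed
  define X where "X = (\<lambda>t. x (t + of_nat (k t) * T))"
  define X' where "X' = (\<lambda>t. x' (t + of_nat (k t) * T))"
  have X: "X t = x (t + of_nat n * T)" "X' t = x' (t + of_nat n * T)" if "0 \<le> t + of_nat n * T" for t n
  proof -
    have eq: "t + of_nat (k t) * T + of_nat n * T = t + of_nat n * T + of_nat (k t) * T" by simp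
    show "X t = x (t + of_nat n * T)" "X' t = x' (t + of_nat n * T)"
      using per[OF that, of "k t"] per[OF k[of t], of n] unfolding X_def X'_def eq by simp_all
  qed
  have der: "(X has_real_derivative X' t) (at t) \<and>
      (X' has_real_derivative h t - c * X' t - g t (X t)) (at t)" for t
  proof -
    \<comment> \<open>One period more than necessary makes the shifted time strictly positive. The
      same \<open>n\<close> then serves in a neighbourhood of \<open>t\<close>, and the derivatives
      are two-sided.\<close>
    define n where "n = Suc (k t)"
    have pos: "0 < t + of_nat n * T"
      using k[of t] T by (simp add: n_def algebra_simps add_nonneg_pos)
    have d: "(x has_real_derivative x' (t + of_nat n * T)) (at (t + of_nat n * T))"
      "(x' has_real_derivative h t - c * x' (t + of_nat n * T) - g t (x (t + of_nat n * T)))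
        (at (t + of_nat n * T))"
    proof -
      have at: "at (t + of_nat n * T) within {0..} = at (t + of_nat n * T)"
        using pos by (intro at_within_interior) auto
      show "(x has_real_derivative x' (t + of_nat n * T)) (at (t + of_nat n * T))"
        "(x' has_real_derivative h t - c * x' (t + of_nat n * T) - g t (x (t + of_nat n * T)))
        (at (t + of_nat n * T))"
        using solD[OF x less_imp_le[OF pos]] periodic_plus_of_nat[OF per_h, of t n]
          periodic_plus_of_nat[OF per_g, of t n] unfolding at by simp_all
    qed
    have ev: "eventually (\<lambda>s. 0 \<le> s + of_nat n * T) (nhds t)"
    proof -
      have "eventually (\<lambda>s. s \<in> {- of_nat n * T<..}) (nhds t)"
        by (rule eventually_nhds_in_open) (use pos in auto)
      then show ?thesis by eventually_elim auto
    qed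
    have "((\<lambda>s. x (s + of_nat n * T)) has_real_derivative x' (t + of_nat n * T)) (at t)"
      "((\<lambda>s. x' (s + of_nat n * T)) has_real_derivative
        h t - c * x' (t + of_nat n * T) - g t (x (t + of_nat n * T))) (at t)"
      using d by (simp_all add: DERIV_shift)
    moreover have "X t = x (t + of_nat n * T)" "X' t = x' (t + of_nat n * T)" using X[of t n] pos by auto
    moreover have "eventually (\<lambda>s. X s = x (s + of_nat n * T)) (nhds t)"
      "eventually (\<lambda>s. X' s = x' (s + of_nat n * T)) (nhds t)"
      using ev by (auto elim: eventually_mono dest: X)
    ultimately show ?thesis
      using DERIV_cong_ev[of t t X "\<lambda>s. x (s + of_nat n * T)"]
        DERIV_cong_ev[of t t X' "\<lambda>s. x' (s + of_nat n * T)"] by simp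
  qed
  have "deriv X = X'" using der DERIV_imp_deriv by blast
  then have "duffing_solution_on UNIV c g h X (deriv X)"
    unfolding duffing_solution_on_def
    by (intro exI[of _ "\<lambda>t. h t - c * X' t - g t (X t)"]) (use der in auto)
  moreover have "X (t + T) = X t" for t
    using X(1)[of "t + T" "k t"] X(1)[of t "Suc (k t)"] k[of t] T by (simp add: algebra_simps add_nonneg_nonneg)
  ultimately show ?thesis
    unfolding periodic_solution_def periodic_fun_simple_def by blast
qed

lemma periodic_solutionD:
  assumes "periodic_solution T c g h x"
  shows "sol x (deriv x)" "x (t + of_nat n * T) = x t" "deriv x (t + of_nat n * T) = deriv x t"
proof -
  have per: "periodic_fun_simple x T" and x: "duffing_solution_on UNIV c g h x (deriv x)"
    using assms by (auto simp: periodic_solution_def)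
  then show "sol x (deriv x)"
    unfolding duffing_solution_on_def by (meson DERIV_subset UNIV_I subset_UNIV)
  show "x (t + of_nat n * T) = x t" for t
    by (rule periodic_plus_of_nat[OF per])
  then have eq: "(\<lambda>t. x (t + of_nat n * T)) = x" by auto
  have "(x has_real_derivative deriv x (t + of_nat n * T)) (at (t + of_nat n * T))"
    using x unfolding duffing_solution_on_def by auto
  then have "(x has_real_derivative deriv x (t + of_nat n * T)) (at t)"
    unfolding DERIV_shift eq .
  then show "deriv x (t + of_nat n * T) = deriv x t"
    using DERIV_imp_deriv by metis
qed

text \<open>Both displacements vanish, so expansiveness equates the initial data. Forward uniqueness
  gives equality for \<open>t \<ge> 0\<close>, and periodicity carries it to negative times.\<close>

lemma periodic_solution_unique:
  assumes x: "periodic_solution T c g h x" and y: "periodic_solution T c g h y"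
  shows "x = y"
proof
  fix t
  obtain \<delta> where \<delta>: "\<delta> > 0" and exp:
    "\<And>x x' y y'. sol x x' \<Longrightarrow> sol y y' \<Longrightarrow>
      \<delta> * (\<bar>x 0 - y 0\<bar> + \<bar>x' 0 - y' 0\<bar>) \<le>
      \<bar>(x T - y T) - (x 0 - y 0)\<bar> + \<bar>(x' T - y' T) - (x' 0 - y' 0)\<bar>"
    by (rule displacement_expansive) blast
  have "\<delta> * (\<bar>x 0 - y 0\<bar> + \<bar>deriv x 0 - deriv y 0\<bar>) \<le> 0"
    using exp[OF periodic_solutionD(1)[OF x] periodic_solutionD(1)[OF y]]
      periodic_solutionD(2,3)[OF x, of 0 1] periodic_solutionD(2,3)[OF y, of 0 1] by simp
  then have ini: "x 0 = y 0" "deriv x 0 = deriv y 0" using \<delta> by (simp_all add: mult_le_0_iff)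
  define n where "n = nat \<lceil>\<bar>t\<bar> / T\<rceil>"
  have "\<bar>t\<bar> / T \<le> of_nat n" unfolding n_def by linarith
  then have "\<bar>t\<bar> \<le> of_nat n * T" using T by (simp add: field_simps)
  then have "0 \<le> t + of_nat n * T" by linarith
  then have "x (t + of_nat n * T) = y (t + of_nat n * T)"
    by (rule sol_unique(1)[OF periodic_solutionD(1)[OF x] periodic_solutionD(1)[OF y] ini])
  then show "x t = y t" using periodic_solutionD(2)[OF x] periodic_solutionD(2)[OF y] by simp
qed

section \<open>Linearization and asymptotic stability\<close>

lemma linearization_error:
  assumes x0: "continuous_on {0..T} x0" and e: "e > 0"
  obtains \<theta> where "\<theta> > 0"
    "\<And>t x. t \<in> {0..T} \<Longrightarrow> \<bar>x - x0 t\<bar> \<le> \<theta> \<Longrightarrow>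
      \<bar>g t x - g t (x0 t) - g' t (x0 t) * (x - x0 t)\<bar> \<le> e * \<bar>x - x0 t\<bar>"
proof -
  \<comment> \<open>As \<open>g'\<close> is merely continuous, the remainder has no quadratic bound.
    Its smallness, uniform in \<open>t\<close>, comes from uniform continuity on a compact tube of
    radius 1 around the orbit.\<close>
  define f where "f = (\<lambda>(t, s). g' t (x0 t + s))"
  let ?K = "{0..T} \<times> {-1..1::real}"
  have "continuous_on ?K f"
    unfolding f_def case_prod_beta
    by (intro continuous_intros continuous_on_compose2[OF x0]) auto
  then have "uniformly_continuous_on ?K f"
    by (rule compact_uniformly_continuous) (intro compact_Times compact_Icc)
  then obtain d where d: "d > 0" "\<And>z w. z \<in> ?K \<Longrightarrow> w \<in> ?K \<Longrightarrow> dist w z < d \<Longrightarrow> dist (f w) (f z) < e"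
    using e unfolding uniformly_continuous_on_def by metis
  define \<theta> where "\<theta> = min 1 (d / 2)"
  have close: "\<bar>g' t (x0 t + s) - g' t (x0 t)\<bar> \<le> e" if "t \<in> {0..T}" "\<bar>s\<bar> \<le> \<theta>" for t s
  proof -
    have "dist (t, s) (t, 0) < d" using that(2) d(1) by (simp add: dist_Pair_Pair \<theta>_def)
    then have "dist (f (t, s)) (f (t, 0)) < e"
      using that by (intro d(2)) (auto simp: \<theta>_def)
    then show ?thesis by (simp add: f_def dist_real_def)
  qed
  have "\<bar>g t x - g t (x0 t) - g' t (x0 t) * (x - x0 t)\<bar> \<le> e * \<bar>x - x0 t\<bar>"
    if t: "t \<in> {0..T}" and x: "\<bar>x - x0 t\<bar> \<le> \<theta>" for t x
  proof -
    let ?f = "\<lambda>y. g t y - g' t (x0 t) * y"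
    have "norm (?f x - ?f (x0 t)) \<le> e * norm (x - x0 t)"
    proof (rule field_differentiable_bound[of "cball (x0 t) \<theta>" ?f "\<lambda>y. g' t y - g' t (x0 t)"])
      fix y assume y: "y \<in> cball (x0 t) \<theta>"
      show "(?f has_real_derivative g' t y - g' t (x0 t)) (at y within cball (x0 t) \<theta>)"
        by (auto intro!: derivative_eq_intros DERIV_subset[OF der_g])
      show "norm (g' t y - g' t (x0 t)) \<le> e"
        using close[OF t, of "y - x0 t"] y by (simp add: dist_real_def abs_minus_commute)
    qed (use x in \<open>auto simp: dist_real_def abs_minus_commute \<theta>_def d less_imp_le[OF d(1)]\<close>)
    then show ?thesis by (simp add: algebra_simps)
  qed
  moreover have "\<theta> > 0" using d by (simp add: \<theta>_def)
  ultimately show ?thesis using that by blast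
qed

text \<open>The deviation of \<open>y\<close> from \<open>x0\<close> is compared with the linear
  solution having the same initial data, which contracts in the adapted norm. Their distance at
  \<open>T\<close> is a small multiple of the initial deviation and fits into half of the gap
  \<open>1 - \<rho>\<close>.\<close>

lemma period_contraction:
  assumes x0: "periodic_solution T c g h x0"
  obtains N K \<rho> \<eta> where "0 < \<rho>" "\<rho> < 1" "1 \<le> K" "0 < \<eta>"
    "\<And>p q. \<bar>p\<bar> + \<bar>q\<bar> \<le> N p q" "\<And>p q. N p q \<le> K * (\<bar>p\<bar> + \<bar>q\<bar>)"
    "\<And>y y'. sol y y' \<Longrightarrow> \<bar>y 0 - x0 0\<bar> + \<bar>y' 0 - deriv x0 0\<bar> < \<eta> \<Longrightarrow>
      N (y T - x0 T) (y' T - deriv x0 T) \<le> \<rho> * N (y 0 - x0 0) (y' 0 - deriv x0 0)"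
proof -
  note s0 = periodic_solutionD(1)[OF x0]
  define a where "a = (\<lambda>t. g' t (x0 t))"
  have cont_x0: "continuous_on UNIV x0"
    using x0 DERIV_isCont unfolding periodic_solution_def duffing_solution_on_def
    by (metis UNIV_I continuous_at_imp_continuous_on)
  have cont_a: "continuous_on UNIV a"
    unfolding a_def by (intro continuous_intros cont_x0)
  have a_abs: "\<bar>a t\<bar> \<le> A" for t using bound by (simp add: a_def)
  obtain u u' v v' where fp: "fundamental_pair T c a u u' v v'"
    using fundamental_pair_exists[OF cont_a a_abs less_imp_le[OF c]] by blast
  have inf: "infinite {t\<in>{0..T}. a t < (pi / T)\<^sup>2 + c\<^sup>2 / 4}"
    by (rule infinite_super[OF _ strict]) (auto simp: a_def)
  obtain r s where rs: "r + s = complex_of_real (u T + v' T)" "r * s = of_real (exp (- c * T))"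
    "cmod r < 1" "cmod s < 1"
    by (rule multipliers_in_disc[OF fp T c _ inf _ _ int_\<beta>])
      (use upper lower in \<open>auto simp: a_def intro: continuous_on_subset[OF cont_\<beta>]\<close>)
  have det: "u T * v' T - v T * u' T = exp (- c * T)" by (rule fundamental_pair_det[OF fp T])
  obtain N :: "real \<Rightarrow> real \<Rightarrow> real" and K \<rho> where N: "0 < \<rho>" "\<rho> < 1" "1 \<le> K"
    "\<And>p q. \<bar>p\<bar> + \<bar>q\<bar> \<le> N p q" "\<And>p q. N p q \<le> K * (\<bar>p\<bar> + \<bar>q\<bar>)"
    "\<And>p q p' q'. N (p + p') (q + q') \<le> N p q + N p' q'"
    "\<And>p q. N (u T * p + v T * q) (u' T * p + v' T * q) \<le> \<rho> * N p q"
    by (rule adapted_norm[of r s "u T" "v' T" "v T" "u' T"]) (use rs det in auto)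
  define L where "L = 1 + c + A"
  define E where "E = exp ((2 + c + A) * T)"
  define E1 where "E1 = exp ((2 * L + 1) * T) * (E + 1) * (T + 1)"
  have L: "0 \<le> L" using c A_nonneg by (simp add: L_def)
  have E: "0 < E" by (simp add: E_def)
  have E1: "0 < E1" using E T by (simp add: E1_def)
  \<comment> \<open>Chosen so that the remainder contributes
    \<open>2 K e E1 = (1 - \<rho>) / 2\<close> per unit of initial deviation.\<close>
  define e where "e = (1 - \<rho>) / (4 * K * E1)"
  have e: "e > 0" using N E1 by (simp add: e_def)
  obtain \<theta> where \<theta>: "\<theta> > 0"
    "\<And>t x. t \<in> {0..T} \<Longrightarrow> \<bar>x - x0 t\<bar> \<le> \<theta> \<Longrightarrow>
      \<bar>g t x - g t (x0 t) - g' t (x0 t) * (x - x0 t)\<bar> \<le> e * \<bar>x - x0 t\<bar>"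
    by (rule linearization_error[OF continuous_on_subset[OF cont_x0] e]) auto
  \<comment> \<open>Over one period a deviation grows at most by the factor \<open>E\<close>;
    starting below \<open>\<theta> / E\<close> it stays where the linearization estimate
    holds.\<close>
  have contr: "N (y T - x0 T) (y' T - deriv x0 T) \<le> (1 + \<rho>) / 2 * N (y 0 - x0 0) (y' 0 - deriv x0 0)"
    if y: "sol y y'" and small: "\<bar>y 0 - x0 0\<bar> + \<bar>y' 0 - deriv x0 0\<bar> < \<theta> / E" for y y'
  proof -
    define p q where "p = y 0 - x0 0" and "q = y' 0 - deriv x0 0"
    define n where "n = \<bar>p\<bar> + \<bar>q\<bar>"
    have n: "0 \<le> n" by (simp add: n_def)
    have small: "E * n < \<theta>" using small E by (simp add: n_def p_def q_def field_simps)
    define w w' where "w = (\<lambda>t. y t - x0 t)" and "w' = (\<lambda>t. y' t - deriv x0 t)"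
    define l l' where "l = (\<lambda>t. p * u t + q * v t)" and "l' = (\<lambda>t. p * u' t + q * v' t)"
    have l: "damped_sol T c a l l'"
      unfolding l_def l'_def using fp by (intro damped_sol_lincomb) (auto simp: fundamental_pair_def)
    have w_bd: "\<bar>w t\<bar> \<le> E * n" if t: "t \<in> {0..T}" for t
    proof -
      have "\<bar>w t\<bar> \<le> norm (w t, w' t)" using abs_components_le_norm(1)[of "(w t, w' t)"] by simp
      also have "\<dots> \<le> exp ((2 + c + A) * t) * norm (w 0, w' 0)"
        unfolding w_def w'_def using t by (intro sol_diff_growth[OF y s0]) auto
      also have "\<dots> \<le> E * n"
        using t c A_nonneg norm_le_sum_abs[of "(w 0, w' 0)"] unfolding E_def
        by (intro mult_mono) (auto simp: n_def p_def q_def w_def w'_def intro!: mult_left_mono)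
      finally show ?thesis .
    qed
    define r where "r = (\<lambda>t. g t (y t) - g t (x0 t) - a t * w t)"
    have r: "\<bar>r t\<bar> \<le> e * E * n" if t: "t \<in> {0..T}" for t
    proof -
      have "\<bar>r t\<bar> \<le> e * \<bar>w t\<bar>"
        unfolding r_def a_def w_def using \<theta>(2)[OF t, of "y t"] w_bd[OF t] small by (simp add: w_def)
      also have "\<dots> \<le> e * (E * n)" using e w_bd[OF t] by (intro mult_left_mono) auto
      finally show ?thesis by (simp add: mult.assoc)
    qed
    \<comment> \<open>This difference starts at 0 and is driven only by the remainder
      \<open>r\<close>, so that \<open>norm_growth_bound\<close> measures it in terms of
      \<open>e\<close>.\<close>
    define d where "d = (\<lambda>t. (w t - l t, w' t - l' t))"
    define d' where "d' = (\<lambda>t. (w' t - l' t, - c * (w' t - l' t) - (a t * (w t - l t) + r t)))"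
    have derd: "(d has_vector_derivative d' t) (at t within {0..T})" if t: "t \<in> {0..T}" for t
    proof -
      have t0: "0 \<le> t" and sub: "{0..T} \<subseteq> {0..}" using t by auto
      note dy = solD[OF y t0, THEN DERIV_subset, OF sub] and dx = solD[OF s0 t0, THEN DERIV_subset, OF sub]
      note dl = damped_sol_subset[OF l order_refl t]
      have "((\<lambda>t. w t - l t) has_real_derivative w' t - l' t) (at t within {0..T})"
        unfolding w_def w'_def by (intro DERIV_diff dy dx dl)
      moreover have "((\<lambda>t. w' t - l' t) has_real_derivative
          - c * (w' t - l' t) - (a t * (w t - l t) + r t)) (at t within {0..T})"
        unfolding w'_def
        by (rule DERIV_cong[OF DERIV_diff[OF DERIV_diff[OF dy(2) dx(2)] dl(2)]])
          (simp add: r_def algebra_simps)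
      ultimately show ?thesis
        unfolding d_def d'_def has_real_derivative_iff_has_vector_derivative
        by (rule has_vector_derivative_Pair)
    qed
    have bd: "norm (d' t) \<le> L * norm (d t) + e * E * n" if t: "t \<in> {0..T}" for t
    proof -
      have "d' t = (w' t - l' t, - c * (w' t - l' t) - a t * (w t - l t)) + (0, - r t)"
        by (simp add: d'_def)
      then have "norm (d' t) \<le> norm (w' t - l' t, - c * (w' t - l' t) - a t * (w t - l t)) + norm (0::real, - r t)"
        by (metis norm_triangle_ineq)
      also have "norm (w' t - l' t, - c * (w' t - l' t) - a t * (w t - l t)) \<le> L * norm (w t - l t, w' t - l' t)"
        unfolding L_def
        by (intro norm_damped_field_le A_nonneg less_imp_le[OF c]) (auto simp: abs_mult intro!: mult_right_mono a_abs)
      also have "norm (0::real, - r t) \<le> e * E * n" using r[OF t] by (simp add: norm_Pair)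
      finally show ?thesis by (simp add: d_def)
    qed
    have d0: "d 0 = 0"
      using fp by (simp add: d_def w_def w'_def l_def l'_def p_def q_def fundamental_pair_def zero_prod_def)
    have "(norm (d T))\<^sup>2 \<le> exp ((2 * L + 1) * T) * ((norm (d 0))\<^sup>2 + (e * E * n)\<^sup>2 * T)"
      by (rule norm_growth_bound[OF derd bd]) (use e E n L T in auto)
    also have "\<dots> = exp ((2 * L + 1) * T) * T * (e * E * n)\<^sup>2" by (simp add: d0)
    \<comment> \<open>Adding 1 to \<open>T\<close> makes the factor at least 1 and hence at most its
      own square, after which the square root can be taken.\<close>
    also have "\<dots> \<le> (exp ((2 * L + 1) * T) * (T + 1))\<^sup>2 * (e * (E + 1) * n)\<^sup>2"
    proof (rule mult_mono)
      have x: "1 \<le> exp ((2 * L + 1) * T)" using L T by simp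
      have "exp ((2 * L + 1) * T) * T \<le> exp ((2 * L + 1) * T) * (T + 1)" by (intro mult_left_mono) auto
      also have "\<dots> \<le> (exp ((2 * L + 1) * T) * (T + 1))\<^sup>2"
      proof (rule self_le_power)
        show "1 \<le> exp ((2 * L + 1) * T) * (T + 1)"
          using mult_mono[OF x, of 1 "T + 1"] T by simp
      qed simp
      finally show "exp ((2 * L + 1) * T) * T \<le> (exp ((2 * L + 1) * T) * (T + 1))\<^sup>2" .
      show "(e * E * n)\<^sup>2 \<le> (e * (E + 1) * n)\<^sup>2"
        using e E n by (intro power_mono mult_right_mono mult_left_mono) auto
    qed auto
    also have "\<dots> = (e * E1 * n)\<^sup>2" 
      unfolding power_mult_distrib[symmetric] E1_def by (simp only: mult_ac)
    finally have dT: "norm (d T) \<le> e * E1 * n"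
      by (rule power2_le_imp_le) (use e E1 n in auto)
    have "N (w T) (w' T) \<le> N (l T) (l' T) + N (w T - l T) (w' T - l' T)"
      using N(6)[of "l T" "w T - l T" "l' T" "w' T - l' T"] by simp
    also have "N (l T) (l' T) \<le> \<rho> * N p q"
      using N(7)[of p q] by (simp add: l_def l'_def mult.commute)
    also have "N (w T - l T) (w' T - l' T) \<le> K * (\<bar>fst (d T)\<bar> + \<bar>snd (d T)\<bar>)"
      using N(5)[of "w T - l T" "w' T - l' T"] by (simp add: d_def)
    also have "\<dots> \<le> K * (2 * (e * E1 * n))"
      using abs_components_le_norm[of "d T"] dT N(3) by (intro mult_left_mono) auto
    also have "\<dots> = (1 - \<rho>) / 2 * n" using N(3) E1 by (simp add: e_def)
    also have "\<dots> \<le> (1 - \<rho>) / 2 * N p q" using N(2) N(4)[of p q] by (intro mult_left_mono) (auto simp: n_def)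
    finally show ?thesis by (simp add: w_def w'_def p_def q_def field_simps)
  qed
  show ?thesis
    by (rule that[where N=N and K=K and \<rho>="(1 + \<rho>) / 2" and \<eta>="\<theta> / E"]) (use N(1-5) \<theta>(1) E contr in auto)
qed

text \<open>The contraction is iterated at multiples of \<open>T\<close>, and the growth bound
  bridges the incomplete last period.\<close>

lemma periodic_solution_stable:
  assumes x0: "periodic_solution T c g h x0"
  shows "asymptotically_stable c g h x0"
proof -
  note s0 = periodic_solutionD(1)[OF x0]
  obtain N K \<rho> \<eta> where N: "0 < \<rho>" "\<rho> < 1" "1 \<le> K" "0 < \<eta>"
    "\<And>p q. \<bar>p\<bar> + \<bar>q\<bar> \<le> N p q" "\<And>p q. N p q \<le> K * (\<bar>p\<bar> + \<bar>q\<bar>)"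
    "\<And>y y'. sol y y' \<Longrightarrow> \<bar>y 0 - x0 0\<bar> + \<bar>y' 0 - deriv x0 0\<bar> < \<eta> \<Longrightarrow>
      N (y T - x0 T) (y' T - deriv x0 T) \<le> \<rho> * N (y 0 - x0 0) (y' 0 - deriv x0 0)"
    by (rule period_contraction[OF x0]) blast
  define E where "E = exp ((2 + c + A) * T)"
  have E: "0 < E" by (simp add: E_def)
  \<comment> \<open>The rate is that of \<rho> per period. In \<open>C\<close>, the factor
    \<open>2 E\<close> bridges part of a period, \<open>K\<close> compares the norms,
    \<open>1 / \<rho>\<close> accounts for rounding \<open>t / T\<close> down, and the summand 1
    makes the estimate strict.\<close>
  define \<gamma> where "\<gamma> = - ln \<rho> / T"
  define C where "C = 2 * E * K / \<rho> + 1"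
  have "\<gamma> > 0" using N T by (simp add: \<gamma>_def divide_neg_pos)
  moreover have "C > 0" using N E by (simp add: C_def add_pos_pos)
  moreover have "\<eta> / K > 0" using N by simp
  moreover have "\<bar>x t - x0 t\<bar> + \<bar>x' t - deriv x0 t\<bar> < C * n * exp (- \<gamma> * t)"
    if x: "sol x x'" and ne: "\<exists>t\<ge>0. x t \<noteq> x0 t"
      and n_def: "n = \<bar>x 0 - x0 0\<bar> + \<bar>x' 0 - deriv x0 0\<bar>" and small: "n < \<eta> / K" and t: "0 \<le> t"
    for x x' n t
  proof -
    \<comment> \<open>The strict estimate would fail for equal initial data; this is where the
      competing solution has to be a different one.\<close>
    have "n \<noteq> 0"
    proof
      assume "n = 0"
      then have "x 0 = x0 0" "x' 0 = deriv x0 0" by (auto simp: n_def)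
      then show False using sol_unique(1)[OF x s0] ne by blast
    qed
    then have n: "0 < n" by (simp add: n_def)
    have Kn: "K * n < \<eta>" using small N(3) by (simp add: field_simps)
    have iter: "N (x (of_nat k * T) - x0 (of_nat k * T)) (x' (of_nat k * T) - deriv x0 (of_nat k * T))
        \<le> \<rho> ^ k * (K * n)" for k
    proof (induction k)
      case 0
      then show ?case using N(6)[of "x 0 - x0 0" "x' 0 - deriv x0 0"] by (simp add: n_def)
    next
      case (Suc k)
      let ?y = "\<lambda>t. x (t + of_nat k * T)" and ?y' = "\<lambda>t. x' (t + of_nat k * T)"
      note per = periodic_solutionD(2,3)[OF x0, of _ k]
      have IH: "N (?y 0 - x0 0) (?y' 0 - deriv x0 0) \<le> \<rho> ^ k * (K * n)"
        using Suc per[of 0] by simp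
      have "\<bar>?y 0 - x0 0\<bar> + \<bar>?y' 0 - deriv x0 0\<bar> \<le> \<rho> ^ k * (K * n)"
        using N(5) IH by (rule order_trans)
      also have "\<dots> \<le> 1 * (K * n)" using N n by (intro mult_right_mono power_le_one) auto
      finally have "\<bar>?y 0 - x0 0\<bar> + \<bar>?y' 0 - deriv x0 0\<bar> < \<eta>" using Kn by linarith
      then have "N (?y T - x0 T) (?y' T - deriv x0 T) \<le> \<rho> * N (?y 0 - x0 0) (?y' 0 - deriv x0 0)"
        by (rule N(7)[OF sol_shift[OF x]])
      also have "\<dots> \<le> \<rho> * (\<rho> ^ k * (K * n))" using IH N(1) by (intro mult_left_mono) auto
      finally show ?case
        using per[of T] by (simp add: algebra_simps)
    qed
    define k where "k = nat \<lfloor>t / T\<rfloor>"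
    have k: "of_nat k \<le> t / T" "t / T < of_nat k + 1"
      using t T unfolding k_def by (simp_all add: of_nat_floor)
    define s where "s = t - of_nat k * T"
    have s: "0 \<le> s" "s \<le> T" using k T by (auto simp: s_def field_simps)
    let ?y = "\<lambda>t. x (t + of_nat k * T)" and ?y' = "\<lambda>t. x' (t + of_nat k * T)"
    note per = periodic_solutionD(2,3)[OF x0, of _ k]
    have ts: "t = s + of_nat k * T" by (simp add: s_def)
    have "\<bar>x t - x0 t\<bar> + \<bar>x' t - deriv x0 t\<bar> = \<bar>?y s - x0 s\<bar> + \<bar>?y' s - deriv x0 s\<bar>"
      using per[of s] by (simp add: ts)
    also have "\<dots> \<le> 2 * norm (?y s - x0 s, ?y' s - deriv x0 s)"
      using abs_components_le_norm[of "(?y s - x0 s, ?y' s - deriv x0 s)"] by simp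
    also have "\<dots> \<le> 2 * (exp ((2 + c + A) * s) * norm (?y 0 - x0 0, ?y' 0 - deriv x0 0))"
      by (intro mult_left_mono sol_diff_growth[OF sol_shift[OF x] s0 s(1)]) auto
    also have "\<dots> \<le> 2 * (E * (\<rho> ^ k * (K * n)))"
    proof -
      have "norm (?y 0 - x0 0, ?y' 0 - deriv x0 0) \<le> \<bar>?y 0 - x0 0\<bar> + \<bar>?y' 0 - deriv x0 0\<bar>"
        using norm_le_sum_abs[of "(?y 0 - x0 0, ?y' 0 - deriv x0 0)"] by simp
      also have "\<dots> \<le> N (?y 0 - x0 0) (?y' 0 - deriv x0 0)" by (rule N(5))
      also have "\<dots> \<le> \<rho> ^ k * (K * n)" using iter[of k] per[of 0] by simp
      finally have "norm (?y 0 - x0 0, ?y' 0 - deriv x0 0) \<le> \<rho> ^ k * (K * n)" .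
      moreover have "exp ((2 + c + A) * s) \<le> E" unfolding E_def using s c A_nonneg by (simp add: mult_left_mono)
      ultimately show ?thesis using E by (intro mult_left_mono mult_mono) auto
    qed
    \<comment> \<open>Since \<open>t / T < k + 1\<close> and \<open>ln \<rho>\<close> is negative,
      \<open>\<rho> ^ (k + 1)\<close> is at most \<open>exp (- \<gamma> * t)\<close>.\<close>
    also have "\<rho> ^ k \<le> exp (- \<gamma> * t) / \<rho>"
    proof -
      have "- \<gamma> * t = t / T * ln \<rho>" using T by (simp add: \<gamma>_def)
      moreover have "(of_nat k + 1) * ln \<rho> \<le> t / T * ln \<rho>"
        using k N by (intro mult_right_mono_neg) auto
      ultimately have "exp ((of_nat k + 1) * ln \<rho>) \<le> exp (- \<gamma> * t)" by simp
      moreover have "exp ((of_nat k + 1) * ln \<rho>) = \<rho> ^ k * \<rho>"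
        using N(1) by (simp add: distrib_right exp_add exp_of_nat_mult)
      ultimately have "\<rho> ^ k * \<rho> \<le> exp (- \<gamma> * t)" by simp
      then show ?thesis using N(1) by (simp add: pos_le_divide_eq)
    qed
    finally have "\<bar>x t - x0 t\<bar> + \<bar>x' t - deriv x0 t\<bar> \<le> 2 * (E * (exp (- \<gamma> * t) / \<rho> * (K * n)))"
      using E N(3) n by (simp add: mult_left_mono mult_right_mono)
    also have "\<dots> = (C - 1) * n * exp (- \<gamma> * t)" by (simp add: C_def)
    also have "\<dots> < C * n * exp (- \<gamma> * t)" using n by (intro mult_strict_right_mono) auto
    finally show ?thesis .
  qed
  ultimately show ?thesis
    unfolding asymptotically_stable_def Let_def
    by (intro exI[of _ C] exI[of _ \<gamma>] exI[of _ "\<eta> / K"] conjI) auto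
qed

end

section \<open>From the stated hypotheses to the locale\<close>

lemma dx_partial_derivative:
  assumes "continuously_differentiable (\<lambda>(t, x). g t x)"
  shows "(g t has_real_derivative dx g t x) (at x)"
    and "continuous_on UNIV (\<lambda>(t, x). dx g t x)"
    and "continuous_on UNIV (\<lambda>(t, x). g t x)"
proof -
  obtain D where D: "\<And>z. ((\<lambda>(t, x). g t x) has_derivative blinfun_apply (D z)) (at z)"
    and cont: "continuous_on UNIV D"
    using assms unfolding continuously_differentiable_def by blast
  \<comment> \<open>The partial derivative is the total derivative applied to \<open>(0, 1)\<close>;
    this formula also passes joint continuity from \<open>D\<close> to \<open>dx g\<close>.\<close>
  have der: "(g t has_real_derivative D (t, x) (0, 1)) (at x)" for t x
  proof -
    have "((\<lambda>y. (t, y)) has_derivative (\<lambda>y. (0, y))) (at x)"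
      by (auto intro!: derivative_eq_intros)
    from has_derivative_compose[OF this, of "\<lambda>(t, x). g t x" "D (t, x)"] D
    have "(g t has_derivative (\<lambda>y. D (t, x) (0, y))) (at x)" by auto
    then show ?thesis
    proof (rule has_derivative_imp_has_field_derivative)
      fix y
      show "y * D (t, x) (0, 1) = D (t, x) (0, y)"
        using blinfun.scaleR_right[of "D (t, x)" y "(0, 1)"] by simp
    qed
  qed
  then have dx: "dx g t x = D (t, x) (0, 1)" for t x
    unfolding dx_def by (rule DERIV_imp_deriv)
  then show "(g t has_real_derivative dx g t x) (at x)" using der by simp
  have "continuous_on UNIV (\<lambda>z. D z (0, 1))"
    by (intro continuous_intros cont)
  then show "continuous_on UNIV (\<lambda>(t, x). dx g t x)" by (simp add: dx case_prod_beta)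
  show "continuous_on UNIV (\<lambda>(t, x). g t x)"
    using D has_derivative_continuous by (blast intro: continuous_at_imp_continuous_on)
qed

theorem theorem1:
  fixes T c :: real and h :: "real \<Rightarrow> real" and g :: "real \<Rightarrow> real \<Rightarrow> real"
  assumes "T > 0" and "c > 0"
    and "continuous_on UNIV h" and "periodic_fun_simple h T"
    and "continuously_differentiable (\<lambda>(t, x). g t x)"
    and "\<And>x. periodic_fun_simple (\<lambda>t. g t x) T"
    and "much_less T (\<lambda>t. SUP x. ereal (dx g t x)) (\<lambda>t. ereal (pi\<^sup>2 / T\<^sup>2 + c\<^sup>2 / 4))"
    and "\<exists>\<beta>. continuous_on UNIV \<beta> \<and> periodic_fun_simple \<beta> T \<and> integral {0..T} \<beta> > 0 \<and>
           (\<forall>x. much_less T \<beta> (\<lambda>t. dx g t x))"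
  shows "(\<exists>!x. periodic_solution T c g h x) \<and>
         (\<forall>x. periodic_solution T c g h x \<longrightarrow> asymptotically_stable c g h x)"
proof -
  obtain \<beta> where \<beta>: "continuous_on UNIV \<beta>" "periodic_fun_simple \<beta> T" "integral {0..T} \<beta> > 0"
    "\<And>x. much_less T \<beta> (\<lambda>t. dx g t x)"
    using assms(8) by blast
  note g = dx_partial_derivative[OF assms(5)]
  have upper: "dx g t x \<le> (pi / T)\<^sup>2 + c\<^sup>2 / 4" if "t \<in> {0..T}" for t x
  proof -
    have "ereal (dx g t x) \<le> (SUP x. ereal (dx g t x))" by (intro SUP_upper) auto
    also have "\<dots> \<le> ereal (pi\<^sup>2 / T\<^sup>2 + c\<^sup>2 / 4)" using assms(7) that by (auto simp: much_less_def)
    finally show ?thesis by (simp add: power_divide)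
  qed
  have lower: "\<beta> t \<le> dx g t x" if "t \<in> {0..T}" for t x
    using \<beta>(4)[of x] that by (auto simp: much_less_def)
  obtain B where B: "\<And>t. \<bar>\<beta> t\<bar> \<le> B"
    by (rule periodic_continuous_bounded[OF \<beta>(1,2) assms(1)]) blast
  \<comment> \<open>On one period \<open>dx g\<close> lies between \<open>- B\<close>, through
    \<beta>, and the upper constant; periodicity of \<open>g\<close> extends the bound to all
    times.\<close>
  define A where "A = max B ((pi / T)\<^sup>2 + c\<^sup>2 / 4)"
  have bound: "\<bar>dx g t x\<bar> \<le> A" for t x
  proof -
    define n where "n = \<lfloor>t / T\<rfloor>"
    define s where "s = t - of_int n * T"
    have "of_int n \<le> t / T" "t / T < of_int n + 1" unfolding n_def by linarith+
    then have s: "s \<in> {0..T}" using assms(1) by (auto simp: s_def field_simps)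
    have "g s = g t"
    proof
      fix y
      interpret periodic_fun_simple "\<lambda>t. g t y" T by (rule assms(6))
      show "g s y = g t y" unfolding s_def by (rule minus_of_int)
    qed
    then have "dx g t x = dx g s x" by (simp add: dx_def)
    then show ?thesis
      using upper[OF s, of x] lower[OF s, of x] B[of s] by (auto simp: A_def)
  qed
  \<comment> \<open>On \<open>S\<close> the strict bound on the supremum holds for all
    \<open>x\<close> at once, hence along any solution, and a set of positive measure is not
    finite.\<close>
  have strict: "infinite {t\<in>{0..T}. \<forall>x. dx g t x < (pi / T)\<^sup>2 + c\<^sup>2 / 4}"
  proof
    assume fin: "finite {t\<in>{0..T}. \<forall>x. dx g t x < (pi / T)\<^sup>2 + c\<^sup>2 / 4}"
    obtain S where S: "S \<in> sets lebesgue" "S \<subseteq> {0..T}" "emeasure lebesgue S > 0"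
      "\<And>t. t \<in> S \<Longrightarrow> (SUP x. ereal (dx g t x)) < ereal (pi\<^sup>2 / T\<^sup>2 + c\<^sup>2 / 4)"
      using assms(7) unfolding much_less_def by blast
    have "S \<subseteq> {t\<in>{0..T}. \<forall>x. dx g t x < (pi / T)\<^sup>2 + c\<^sup>2 / 4}"
    proof
      fix t assume t: "t \<in> S"
      have "ereal (dx g t x) < ereal (pi\<^sup>2 / T\<^sup>2 + c\<^sup>2 / 4)" for x
        using S(4)[OF t] by (rule le_less_trans[rotated]) (auto intro: SUP_upper)
      then show "t \<in> {t\<in>{0..T}. \<forall>x. dx g t x < (pi / T)\<^sup>2 + c\<^sup>2 / 4}"
        using S(2) t by (auto simp: power_divide)
    qed
    then have "finite S" using fin finite_subset by blast
    then have "S \<in> null_sets lebesgue" using negligible_finite negligible_iff_null_sets by blast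
    then show False using S(3) by auto
  qed
  interpret duffing T c A h \<beta> g "dx g"
    by (rule duffing.intro) (use assms(1-4,6) \<beta> g upper lower bound strict in auto)
  show ?thesis
    using periodic_solution_exists periodic_solution_unique periodic_solution_stable by blast
qed

end
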